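(* Let $n\ge 3$, let $N\ge1$, let $s_1,\dots,s_N$ be positive integers, and let $j_1,\dots,j_N\in\mathbb{Z}_{\ge0}$ be pairwise distinct. Then the set of Nakajima monomials $$\prod_{k=1}^N\tau_{j_k}(\mathcal{M}^{1,s_k})=\Big\{\prod_{k=1}^N\tau_{j_k}(m_k)\ \Big|\ m_k\in\mathcal{M}^{1,s_k}\Big\},$$ with the Nakajima monomial crystal structure, is isomorphic as a $U_q'(\widehat{\mathfrak{sl}}_n)$-crystal to the tensor product of Kirillov--Reshetikhin crystals $\bigotimes_{k=1}^N B^{1,s_k}=B^{1,s_1}\otimes\cdots\otimes B^{1,s_N}$.
   Context: Crystals. $I=\mathbb{Z}/n\mathbb{Z}=\{0,1,\dots,n-1\}$ is the index set of $\widehat{\mathfrak{sl}}_n$ (type $A_{n-1}^{(1)}$), with simple coroots $h_i$, fundamental weights $\Lambda_i$ ($\langle h_i,\Lambda_j\rangle=\delta_{ij}$), and simple roots $\alpha_i=2\Lambda_i-\Lambda_{i-1}-\Lambda_{i+1}$ as $U_q'(\widehat{\mathfrak{sl}}_n)$-weights (that is, modulo the null root $\delta$). A $U_q'(\widehat{\mathfrak{sl}}_n)$-crystal is a set $B$ with maps $e_i,f_i:B\to B\sqcup\{0\}$, $\varepsilon_i,\varphi_i:B\to\mathbb{Z}$ and $\mathrm{wt}:B\to\bigoplus_i\mathbb{Z}\Lambda_i$ satisfying the usual crystal axioms. An isomorphism of crystals is a bijection that preserves $\mathrm{wt},\varepsilon_i,\varphi_i$ and commutes with all $e_i,f_i$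 (with $0\mapsto 0$). Tensor product (opposite to Kashiwara's convention). $B_2\otimes B_1$ is the set $B_2\times B_1$ with $e_i(b_2\otimes b_1)=e_ib_2\otimes b_1$ if $\varepsilon_i(b_2)>\varphi_i(b_1)$ and $b_2\otimes e_ib_1$ otherwise; $f_i(b_2\otimes b_1)=f_ib_2\otimes b_1$ if $\varepsilon_i(b_2)\ge\varphi_i(b_1)$ and $b_2\otimes f_ib_1$ otherwise; $\varepsilon_i(b_2\otimes b_1)=\max(\varepsilon_i(b_1),\varepsilon_i(b_2)-\langle h_i,\mathrm{wt}(b_1)\rangle)$; $\varphi_i(b_2\otimes b_1)=\max(\varphi_i(b_2),\varphi_i(b_1)+\langle h_i,\mathrm{wt}(b_2)\rangle)$; $\mathrm{wt}(b_2\otimes b_1)=\mathrm{wt}(b_2)+\mathrm{wt}(b_1)$. Nakajima monomials. $\mathcal{M}$ is the set of Laurent monomials $m=\prod_{i\in I,k\in\mathbb{Z}}Y_{i,k}^{y_{i,k}}$ (finitely many nonzero exponents) in commuting variables $Y_{i,k}$. Put $\mathrm{wt}(m)=\sum_{i,k}y_{i,k}\Lambda_i$, $\ \varepsilon_i(m)=-\min_{k\in\mathbb{Z}}\sum_{t\ge k}y_{i,t}$, $\ \varphi_i(m)=\max_{k\in\mathbb{Z}}\sum_{t\le k}y_{i,t}$, $\ k_e(m)=\max\{k\mid \varepsilon_i(m)=-\sum_{t\ge k}y_{i,t}\}$ (used when $\varepsilon_i(m)>0$), $\ k_f(m)=\min\{k\mid\varphi_i(m)=\sum_{t\le k}y_{i,t}\}$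 (used when $\varphi_i(m)>0$). With $A_{i,k}=Y_{i,k}Y_{i,k+1}Y_{i-1,k+1}^{-1}Y_{i+1,k}^{-1}$, set $e_i(m)=0$ if $\varepsilon_i(m)=0$ and $e_i(m)=m\,A_{i,k_e(m)-1}$ otherwise; $f_i(m)=0$ if $\varphi_i(m)=0$ and $f_i(m)=m\,A_{i,k_f(m)}^{-1}$ otherwise. For $j\in\mathbb{Z}$, $\tau_j$ is the shift $Y_{i,k}\mapsto Y_{i,k+j}$ extended multiplicatively. For $s\ge1$, $\mathcal{M}^{1,s}=\{\prod_{i=1}^nY_{i-1,1}^{-x_i}Y_{i,0}^{x_i}\mid x_i\in\mathbb{Z}_{\ge0},\ \sum_{i=1}^nx_i=s\}$ (first indices mod $n$). The crystal $B^{1,s}$ (vector realization). $B^{1,s}=\{(x_1,\dots,x_n)\in\mathbb{Z}_{\ge0}^n\mid\sum_i x_i=s\}$, with indices mod $n$ (so $x_0=x_n$), and for $i\in I$: $\varepsilon_i(x)=x_{i+1}$, $\varphi_i(x)=x_i$, $\mathrm{wt}(x)=\sum_{i\in I}(x_i-x_{i+1})\Lambda_i$; $e_i(x)=0$ if $x_{i+1}=0$, and otherwise $e_i$ increases $x_i$ by $1$ and decreases $x_{i+1}$ by $1$; $f_i(x)=0$ if $x_i=0$, and otherwise $f_i$ decreases $x_i$ by $1$ and increases $x_{i+1}$ by $1$. *)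

theory Defs
  imports Main "HOL-Library.Poly_Mapping"
begin

text \<open>The index set $I = Z/nZ$ is represented by the residues \<open>{..<n}\<close>.\<close>

definition nxt :: "nat \<Rightarrow> nat \<Rightarrow> nat" where
  "nxt n i = (i + 1) mod n"

definition prv :: "nat \<Rightarrow> nat \<Rightarrow> nat" where
  "prv n i = (i + n - 1) mod n"

text \<open>A weight is a finite integer combination of the fundamental weights \<open>Lam i\<close>; the pairing
  with the coroot \<open>h i\<close> is the coefficient of \<open>Lam i\<close>.\<close>

type_synonym weight = "nat \<Rightarrow>\<^sub>0 int"

definition Lam :: "nat \<Rightarrow> weight" where
  "Lam i = Poly_Mapping.single i 1"

definition pairing :: "nat \<Rightarrow> weight \<Rightarrow> int" where
  "pairing i \<mu> = Poly_Mapping.lookup \<mu> i"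

definition alpha :: "nat \<Rightarrow> nat \<Rightarrow> weight" where
  "alpha n i = Lam i + Lam i - Lam (prv n i) - Lam (nxt n i)"

text \<open>In \<open>e\<close> and \<open>f\<close> the value \<open>None\<close> is the extra element 0. Values outside \<open>elts\<close>, and at
  indices outside \<open>{..<n}\<close>, are irrelevant.\<close>

record 'b crystal_data =
  elts :: "'b set"
  e_op :: "nat \<Rightarrow> 'b \<Rightarrow> 'b option"
  f_op :: "nat \<Rightarrow> 'b \<Rightarrow> 'b option"
  eps :: "nat \<Rightarrow> 'b \<Rightarrow> int"
  phi :: "nat \<Rightarrow> 'b \<Rightarrow> int"
  wt :: "'b \<Rightarrow> weight"

locale crystal =
  fixes n :: nat and B :: "'b crystal_data"
  assumes wt_support: "b \<in> elts B \<Longrightarrow> Poly_Mapping.keys (wt B b) \<subseteq> {..<n}"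
    and phi_eps: "\<lbrakk>i < n; b \<in> elts B\<rbrakk> \<Longrightarrow> phi B i b = eps B i b + pairing i (wt B b)"
    and e_closed: "\<lbrakk>i < n; b \<in> elts B; e_op B i b = Some b'\<rbrakk> \<Longrightarrow> b' \<in> elts B"
    and f_closed: "\<lbrakk>i < n; b \<in> elts B; f_op B i b = Some b'\<rbrakk> \<Longrightarrow> b' \<in> elts B"
    and e_shift: "\<lbrakk>i < n; b \<in> elts B; e_op B i b = Some b'\<rbrakk> \<Longrightarrow>
      wt B b' = wt B b + alpha n i \<and> eps B i b' = eps B i b - 1 \<and> phi B i b' = phi B i b + 1"
    and f_shift: "\<lbrakk>i < n; b \<in> elts B; f_op B i b = Some b'\<rbrakk> \<Longrightarrow>
      wt B b' = wt B b - alpha n i \<and> eps B i b' = eps B i b + 1 \<and> phi B i b' = phi B i b - 1"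
    and e_f_inverse: "\<lbrakk>i < n; b \<in> elts B; b' \<in> elts B\<rbrakk> \<Longrightarrow>
      f_op B i b = Some b' \<longleftrightarrow> e_op B i b' = Some b"

definition crystal_isomorphism ::
    "nat \<Rightarrow> ('b \<Rightarrow> 'c) \<Rightarrow> 'b crystal_data \<Rightarrow> 'c crystal_data \<Rightarrow> bool" where
  "crystal_isomorphism n \<psi> B C \<longleftrightarrow>
     bij_betw \<psi> (elts B) (elts C) \<and>
     (\<forall>b\<in>elts B. wt C (\<psi> b) = wt B b \<and>
       (\<forall>i<n. eps C i (\<psi> b) = eps B i b \<and> phi C i (\<psi> b) = phi B i b \<and>
              e_op C i (\<psi> b) = map_option \<psi> (e_op B i b) \<and>
              f_op C i (\<psi> b) = map_option \<psi> (f_op B i b)))"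

definition crystal_isomorphic :: "nat \<Rightarrow> 'b crystal_data \<Rightarrow> 'c crystal_data \<Rightarrow> bool" where
  "crystal_isomorphic n B C \<longleftrightarrow>
     crystal n B \<and> crystal n C \<and> (\<exists>\<psi>. crystal_isomorphism n \<psi> B C)"

text \<open>Tensor product, in the convention opposite to Kashiwara's. The pair \<open>(b2, b1)\<close> is the
  tensor of \<open>b2\<close> and \<open>b1\<close>.\<close>

definition tensor :: "'b crystal_data \<Rightarrow> 'c crystal_data \<Rightarrow> ('b \<times> 'c) crystal_data" where
  "tensor B2 B1 = \<lparr>
     elts = elts B2 \<times> elts B1,
     e_op = (\<lambda>i (b2, b1).
       if eps B2 i b2 > phi B1 i b1 then map_option (\<lambda>b. (b, b1)) (e_op B2 i b2)
       else map_option (\<lambda>b. (b2, b)) (e_op B1 i b1)),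
     f_op = (\<lambda>i (b2, b1).
       if eps B2 i b2 \<ge> phi B1 i b1 then map_option (\<lambda>b. (b, b1)) (f_op B2 i b2)
       else map_option (\<lambda>b. (b2, b)) (f_op B1 i b1)),
     eps = (\<lambda>i (b2, b1). max (eps B1 i b1) (eps B2 i b2 - pairing i (wt B1 b1))),
     phi = (\<lambda>i (b2, b1). max (phi B2 i b2) (phi B1 i b1 + pairing i (wt B2 b2))),
     wt = (\<lambda>(b2, b1). wt B2 b2 + wt B1 b1) \<rparr>"

text \<open>Iterated tensor products of a varying number of factors need a single element type, so
  nested pairs are renamed to lists: \<open>relabel g h\<close> transports a crystal along the injection \<open>g\<close>
  with left inverse \<open>h\<close>. The product is bracketed to the right and only meant for nonempty
  lists of factors.\<close>

definition relabel :: "('b \<Rightarrow> 'c) \<Rightarrow> ('c \<Rightarrow> 'b) \<Rightarrow> 'b crystal_data \<Rightarrow> 'c crystal_data" where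
  "relabel g h B = \<lparr>
     elts = g ` elts B,
     e_op = (\<lambda>i c. map_option g (e_op B i (h c))),
     f_op = (\<lambda>i c. map_option g (f_op B i (h c))),
     eps = (\<lambda>i c. eps B i (h c)),
     phi = (\<lambda>i c. phi B i (h c)),
     wt = (\<lambda>c. wt B (h c)) \<rparr>"

fun tensor_list :: "'b crystal_data list \<Rightarrow> 'b list crystal_data" where
  "tensor_list [] = undefined"
| "tensor_list [B] = relabel (\<lambda>b. [b]) hd B"
| "tensor_list (B # C # Cs) =
     relabel (\<lambda>(b, bs). b # bs) (\<lambda>xs. (hd xs, tl xs)) (tensor B (tensor_list (C # Cs)))"

text \<open>The vector $(x_1, \dots, x_n)$ is a function on the residues, so $x_n$ is stored at 0; it
  vanishes outside \<open>{..<n}\<close> to make the representation unique.\<close>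

definition KR_crystal :: "nat \<Rightarrow> nat \<Rightarrow> (nat \<Rightarrow> nat) crystal_data" where
  "KR_crystal n s = \<lparr>
     elts = {x. (\<forall>i\<ge>n. x i = 0) \<and> (\<Sum>i<n. x i) = s},
     e_op = (\<lambda>i x. if x (nxt n i) = 0 then None
       else Some (x(i := x i + 1, nxt n i := x (nxt n i) - 1))),
     f_op = (\<lambda>i x. if x i = 0 then None
       else Some (x(i := x i - 1, nxt n i := x (nxt n i) + 1))),
     eps = (\<lambda>i x. int (x (nxt n i))),
     phi = (\<lambda>i x. int (x i)),
     wt = (\<lambda>x. \<Sum>i<n. Poly_Mapping.single i (int (x i) - int (x (nxt n i)))) \<rparr>"

text \<open>A Laurent monomial is its finitely supported family of exponents: \<open>Poly_Mapping.lookup m (i, k)\<close> is the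
  exponent of $Y_{i,k}$. Multiplication of monomials is addition here, and inversion is
  negation.\<close>

type_synonym monomial = "nat \<times> int \<Rightarrow>\<^sub>0 int"

definition Ypow :: "nat \<Rightarrow> int \<Rightarrow> int \<Rightarrow> monomial" where
  "Ypow i k a = Poly_Mapping.single (i, k) a"

definition A_mon :: "nat \<Rightarrow> nat \<Rightarrow> int \<Rightarrow> monomial" where
  "A_mon n i k = Ypow i k 1 + Ypow i (k + 1) 1 + Ypow (prv n i) (k + 1) (-1) + Ypow (nxt n i) k (-1)"

definition upper_sum :: "nat \<Rightarrow> monomial \<Rightarrow> int \<Rightarrow> int" where
  "upper_sum i m k = (\<Sum>t | k \<le> t \<and> (i, t) \<in> Poly_Mapping.keys m. Poly_Mapping.lookup m (i, t))"

definition lower_sum :: "nat \<Rightarrow> monomial \<Rightarrow> int \<Rightarrow> int" where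
  "lower_sum i m k = (\<Sum>t | t \<le> k \<and> (i, t) \<in> Poly_Mapping.keys m. Poly_Mapping.lookup m (i, t))"

text \<open>The partial sums take only finitely many values, so \<open>Min\<close> and \<open>Max\<close> are proper here. The
  sets defining \<open>k_e\<close> and \<open>k_f\<close> may be infinite on one side, hence \<open>GREATEST\<close> and \<open>LEAST\<close>;
  these exist when \<open>mon_eps\<close> and \<open>mon_phi\<close>, respectively, are positive.\<close>

definition mon_eps :: "nat \<Rightarrow> monomial \<Rightarrow> int" where
  "mon_eps i m = - Min (range (upper_sum i m))"

definition mon_phi :: "nat \<Rightarrow> monomial \<Rightarrow> int" where
  "mon_phi i m = Max (range (lower_sum i m))"

definition k_e :: "nat \<Rightarrow> monomial \<Rightarrow> int" where
  "k_e i m = (GREATEST k. mon_eps i m = - upper_sum i m k)"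

definition k_f :: "nat \<Rightarrow> monomial \<Rightarrow> int" where
  "k_f i m = (LEAST k. mon_phi i m = lower_sum i m k)"

definition monomial_crystal :: "nat \<Rightarrow> monomial set \<Rightarrow> monomial crystal_data" where
  "monomial_crystal n S = \<lparr>
     elts = S,
     e_op = (\<lambda>i m. if mon_eps i m = 0 then None else Some (m + A_mon n i (k_e i m - 1))),
     f_op = (\<lambda>i m. if mon_phi i m = 0 then None else Some (m - A_mon n i (k_f i m))),
     eps = mon_eps,
     phi = mon_phi,
     wt = (\<lambda>m. \<Sum>(i, k)\<in>Poly_Mapping.keys m. Poly_Mapping.single i (Poly_Mapping.lookup m (i, k))) \<rparr>"

text \<open>The shift $Y_{i,k} \mapsto Y_{i,k+j}$; note that \<open>map_key\<close> precomposes.\<close>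

definition tau :: "int \<Rightarrow> monomial \<Rightarrow> monomial" where
  "tau j m = Poly_Mapping.map_key (\<lambda>(i, k). (i, k - j)) m"

definition M1 :: "nat \<Rightarrow> nat \<Rightarrow> monomial set" where
  "M1 n s = {\<Sum>i<n. Ypow (prv n i) 1 (- int (x i)) + Ypow i 0 (int (x i)) | x :: nat \<Rightarrow> nat.
     (\<Sum>i<n. x i) = s}"

definition M_prod :: "nat \<Rightarrow> nat \<Rightarrow> (nat \<Rightarrow> nat) \<Rightarrow> (nat \<Rightarrow> nat) \<Rightarrow> monomial set" where
  "M_prod n N s j = {\<Sum>k=1..N. tau (int (j k)) (m k) | m :: nat \<Rightarrow> monomial.
     \<forall>k\<in>{1..N}. m k \<in> M1 n (s k)}"

lemma lookup_tau: "Poly_Mapping.lookup (tau j m) (i, k) = Poly_Mapping.lookup m (i, k - j)"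
proof -
  have "inj (\<lambda>(i :: nat, k). (i, k - j))"
    by (auto simp: inj_def)
  then show ?thesis
    by (simp add: tau_def map_key.rep_eq)
qed

lemma tau_Ypow: "tau j (Ypow i k a) = Ypow i (k + j) a"
  by (rule poly_mapping_eqI)
     (auto simp: lookup_tau Ypow_def lookup_single when_def split: if_splits)

end

theory Submission
  imports Defs
begin

text \<open>If a monomial \<open>m\<close> involves only levels above \<open>j\<close>, then multiplying it by the monomial
  $\tau_j(m_x)$ of a vector \<open>x\<close> changes the partial sums exactly as the tensor rule prescribes for
  \<open>x \<otimes> m\<close>: the extremal partial sum that selects the level of $e_i$ or $f_i$ sits either at the
  lowest factor or strictly above it. Peeling off the lowest level therefore identifies the product
  of monomials with the tensor product whose factors are sorted by the shifts $j_k$. For an arbitrary order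
  of the shifts, adjacent factors are exchanged by the combinatorial R-matrix
  $B^{1,s} \otimes B^{1,s'} \cong B^{1,s'} \otimes B^{1,s}$, which is described by a matching of the entries
  of the two vectors around the circle: all unmatched entries move to the other factor.\<close>

section \<open>Isomorphisms and tensor products of crystals\<close>

text \<open>Neighbouring factors overlap: the monomial of a vector at shift j occupies the levels j
  and j + 1, and the next factor may start at j + 1. Peeling can therefore assume only that the
  remaining monomial has no exponents up to level j. Distinct shifts provide exactly this after
  sorting: the exponents at level j come from the vector alone, which also makes the multiplication
  injective. The lowest level has to be the left tensor factor because of ties: \<open>k_f\<close>
  is a minimum and f_i prefers the left factor when eps = phi, whereas \<open>k_e\<close> is a
  maximum and e_i then prefers the right one.

  That the product set is closed under e_i and f_i is never checked on monomials; the axioms are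
  transported from the tensor product.

  The matching behind the R-matrix is a relation with hidden counters. It is total and single-valued
  in both directions, and the backward statements follow from the forward ones by reflecting the
  circle. Matching everything requires the left vector to be at least as large as the right one; the
  other case is the inverse isomorphism.\<close>

lemma crystalI:
  assumes "\<And>b. b \<in> elts B \<Longrightarrow> Poly_Mapping.keys (wt B b) \<subseteq> {..<n}"
    and "\<And>i b. \<lbrakk>i < n; b \<in> elts B\<rbrakk> \<Longrightarrow> phi B i b = eps B i b + pairing i (wt B b)"
    and e_closed: "\<And>i b b'. \<lbrakk>i < n; b \<in> elts B; e_op B i b = Some b'\<rbrakk> \<Longrightarrow> b' \<in> elts B"
    and "\<And>i b b'. \<lbrakk>i < n; b \<in> elts B; f_op B i b = Some b'\<rbrakk> \<Longrightarrow> b' \<in> elts B"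
    and f_shift: "\<And>i b b'. \<lbrakk>i < n; b \<in> elts B; f_op B i b = Some b'\<rbrakk> \<Longrightarrow>
      wt B b' = wt B b - alpha n i \<and> eps B i b' = eps B i b + 1 \<and> phi B i b' = phi B i b - 1"
    and inverse: "\<And>i b b'. \<lbrakk>i < n; b \<in> elts B; b' \<in> elts B\<rbrakk> \<Longrightarrow>
      f_op B i b = Some b' \<longleftrightarrow> e_op B i b' = Some b"
  shows "crystal n B"
proof
  fix i b b'
  assume "i < n" "b \<in> elts B" "e_op B i b = Some b'"
  then show "wt B b' = wt B b + alpha n i \<and> eps B i b' = eps B i b - 1 \<and> phi B i b' = phi B i b + 1"
    using f_shift[of i b' b] inverse[of i b' b] e_closed[of i b b'] by auto
qed (fact assms)+

lemma crystal_isomorphismD: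
  assumes "crystal_isomorphism n \<psi> B C"
  shows "bij_betw \<psi> (elts B) (elts C)"
    and "b \<in> elts B \<Longrightarrow> wt C (\<psi> b) = wt B b"
    and "b \<in> elts B \<Longrightarrow> i < n \<Longrightarrow> eps C i (\<psi> b) = eps B i b"
    and "b \<in> elts B \<Longrightarrow> i < n \<Longrightarrow> phi C i (\<psi> b) = phi B i b"
    and "b \<in> elts B \<Longrightarrow> i < n \<Longrightarrow> e_op C i (\<psi> b) = map_option \<psi> (e_op B i b)"
    and "b \<in> elts B \<Longrightarrow> i < n \<Longrightarrow> f_op C i (\<psi> b) = map_option \<psi> (f_op B i b)"
  using assms unfolding crystal_isomorphism_def by auto

lemma crystal_isomorphism_elts:
  assumes "crystal_isomorphism n \<psi> B C" "b \<in> elts B"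
  shows "\<psi> b \<in> elts C"
  using crystal_isomorphismD(1)[OF assms(1)] assms(2) by (auto simp: bij_betw_def)

text \<open>This is how sets of monomials become crystals: closure and the shift axioms come from
  the tensor product on the other side of the bijection.\<close>

lemma crystal_transport:
  assumes B: "crystal n B" and iso: "crystal_isomorphism n \<psi> B C"
  shows "crystal n C"
proof -
  note D = crystal_isomorphismD[OF iso]
  have inj: "\<psi> b = \<psi> b' \<longleftrightarrow> b = b'" if "b \<in> elts B" "b' \<in> elts B" for b b'
    using D(1) that by (auto simp: bij_betw_def inj_on_def)
  have elts: "elts C = \<psi> ` elts B"
    using D(1) by (auto simp: bij_betw_def)
  show ?thesis
  proof (rule crystalI, unfold elts, goal_cases)
    case (1 c)
    then show ?case using crystal.wt_support[OF B] D(2) by fastforce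
  next
    case (2 i c)
    then show ?case using crystal.phi_eps[OF B] D by auto
  next
    case (3 i c c')
    then obtain b b' where "b \<in> elts B" "c = \<psi> b" "e_op B i b = Some b'" "c' = \<psi> b'"
      using D(5) by auto
    then show ?case using crystal.e_closed[OF B \<open>i < n\<close>] by blast
  next
    case (4 i c c')
    then obtain b b' where "b \<in> elts B" "c = \<psi> b" "f_op B i b = Some b'" "c' = \<psi> b'"
      using D(6) by auto
    then show ?case using crystal.f_closed[OF B \<open>i < n\<close>] by blast
  next
    case (5 i c c')
    then obtain b b' where b: "b \<in> elts B" "c = \<psi> b" "f_op B i b = Some b'" "c' = \<psi> b'"
      using D(6) by auto
    then have "b' \<in> elts B" using crystal.f_closed[OF B \<open>i < n\<close>] by blast
    then show ?case using crystal.f_shift[OF B \<open>i < n\<close> b(1,3)] D(2-4) b 5 by simp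
  next
    case (6 i c c')
    then obtain b b' where b: "b \<in> elts B" "c = \<psi> b" "b' \<in> elts B" "c' = \<psi> b'"
      by auto
    have "f_op C i c = Some c' \<longleftrightarrow> f_op B i b = Some b'"
      using D(6)[OF b(1) \<open>i < n\<close>] b crystal.f_closed[OF B \<open>i < n\<close> b(1)] inj
      by (cases "f_op B i b") auto
    moreover have "e_op C i c' = Some c \<longleftrightarrow> e_op B i b' = Some b"
      using D(5)[OF b(3) \<open>i < n\<close>] b crystal.e_closed[OF B \<open>i < n\<close> b(3)] inj
      by (cases "e_op B i b'") auto
    ultimately show ?case using crystal.e_f_inverse[OF B \<open>i < n\<close> b(1,3)] by simp
  qed
qed

lemma crystal_isomorphicI:
  assumes "crystal n B" and "crystal_isomorphism n \<psi> B C"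
  shows "crystal_isomorphic n B C"
  using assms crystal_transport by (auto simp: crystal_isomorphic_def)

text \<open>In a crystal e_i is the partial inverse of f_i, so a bijection that respects f_i
  respects e_i. If e_i were defined on the image only, surjectivity would provide a preimage of its
  value, and f_i would lead from there back to \<open>b\<close>.\<close>

lemma crystal_isomorphism_if_f:
  assumes B: "crystal n B" and C: "crystal n C" and bij: "bij_betw \<psi> (elts B) (elts C)"
    and "\<And>b. b \<in> elts B \<Longrightarrow> wt C (\<psi> b) = wt B b"
    and "\<And>i b. \<lbrakk>i < n; b \<in> elts B\<rbrakk> \<Longrightarrow> eps C i (\<psi> b) = eps B i b"
    and "\<And>i b. \<lbrakk>i < n; b \<in> elts B\<rbrakk> \<Longrightarrow> phi C i (\<psi> b) = phi B i b"
    and f: "\<And>i b. \<lbrakk>i < n; b \<in> elts B\<rbrakk> \<Longrightarrow> f_op C i (\<psi> b) = map_option \<psi> (f_op B i b)"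
  shows "crystal_isomorphism n \<psi> B C"
proof -
  have "e_op C i (\<psi> b) = map_option \<psi> (e_op B i b)" if ib: "i < n" "b \<in> elts B" for i b
  proof (cases "e_op B i b")
    case (Some b')
    then have b': "b' \<in> elts B" using crystal.e_closed[OF B ib] by blast
    then have "f_op B i b' = Some b"
      using crystal.e_f_inverse[OF B ib(1) b' ib(2)] Some by simp
    then have "f_op C i (\<psi> b') = Some (\<psi> b)" using f[OF ib(1) b'] by simp
    then have "e_op C i (\<psi> b) = Some (\<psi> b')"
      using crystal.e_f_inverse[OF C ib(1), of "\<psi> b'" "\<psi> b"] bij ib b'
      by (auto simp: bij_betw_def)
    then show ?thesis using Some by simp
  next
    case None
    have "e_op C i (\<psi> b) \<noteq> Some c" for c
    proof
      assume c: "e_op C i (\<psi> b) = Some c"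
      have \<psi>b: "\<psi> b \<in> elts C" using bij ib by (auto simp: bij_betw_def)
      then have "c \<in> elts C" using crystal.e_closed[OF C ib(1)] c by blast
      then obtain b' where b': "b' \<in> elts B" "c = \<psi> b'" using bij by (auto simp: bij_betw_def)
      have "f_op C i c = Some (\<psi> b)"
        using crystal.e_f_inverse[OF C ib(1) \<open>c \<in> elts C\<close> \<psi>b] c by simp
      then obtain b'' where b'': "f_op B i b' = Some b''" "\<psi> b'' = \<psi> b"
        using f[OF ib(1) b'(1)] b'(2) by auto
      have "b'' = b"
        using bij crystal.f_closed[OF B ib(1) b'(1) b''(1)] ib(2) b''(2)
        by (auto simp: bij_betw_def inj_on_def)
      then have "e_op B i b = Some b'"
        using crystal.e_f_inverse[OF B ib(1) b'(1) ib(2)] b''(1) by simp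
      then show False using None by simp
    qed
    then show ?thesis using None by (cases "e_op C i (\<psi> b)") auto
  qed
  then show ?thesis using assms(3-7) by (simp add: crystal_isomorphism_def)
qed

lemma crystal_isomorphic_refl: "crystal n B \<Longrightarrow> crystal_isomorphic n B B"
  by (rule crystal_isomorphicI[where \<psi> = id])
     (auto simp: crystal_isomorphism_def option.map_id)

lemma crystal_isomorphic_sym:
  assumes "crystal_isomorphic n B C"
  shows "crystal_isomorphic n C B"
proof -
  from assms obtain \<psi> where B: "crystal n B" and C: "crystal n C"
    and iso: "crystal_isomorphism n \<psi> B C"
    by (auto simp: crystal_isomorphic_def)
  note D = crystal_isomorphismD[OF iso]
  define \<chi> where "\<chi> = inv_into (elts B) \<psi>"
  have bij: "bij_betw \<chi> (elts C) (elts B)"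
    unfolding \<chi>_def using D(1) by (rule bij_betw_inv_into)
  have \<chi>: "\<chi> c \<in> elts B" "\<psi> (\<chi> c) = c" if "c \<in> elts C" for c
    using bij that bij_betw_inv_into_right[OF D(1) that]
    by (auto simp: bij_betw_def \<chi>_def)
  have \<psi>: "\<chi> (\<psi> b) = b" if "b \<in> elts B" for b
    using bij_betw_inv_into_left[OF D(1) that] by (simp add: \<chi>_def)
  have "crystal_isomorphism n \<chi> C B"
  proof (rule crystal_isomorphism_if_f[OF C B bij], goal_cases)
    case (1 c)
    then show ?case using D(2)[OF \<chi>(1)] \<chi>(2) by auto
  next
    case (2 i c)
    then show ?case using D(3)[OF \<chi>(1)] \<chi>(2) by auto
  next
    case (3 i c)
    then show ?case using D(4)[OF \<chi>(1)] \<chi>(2) by auto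
  next
    case (4 i c)
    then have "f_op C i c = map_option \<psi> (f_op B i (\<chi> c))"
      using D(6)[OF \<chi>(1), of c i] \<chi>(2) by auto
    then show ?case
      using crystal.f_closed[OF B \<open>i < n\<close> \<chi>(1)] 4 \<psi> by (cases "f_op B i (\<chi> c)") auto
  qed
  then show ?thesis using crystal_isomorphicI[OF C] by blast
qed

lemma crystal_isomorphic_trans [trans]:
  assumes "crystal_isomorphic n B C" "crystal_isomorphic n C D"
  shows "crystal_isomorphic n B D"
proof -
  from assms obtain \<psi> \<chi> where B: "crystal n B" and iso: "crystal_isomorphism n \<psi> B C"
    and iso': "crystal_isomorphism n \<chi> C D"
    by (auto simp: crystal_isomorphic_def)
  have "crystal_isomorphism n (\<chi> \<circ> \<psi>) B D"
    unfolding crystal_isomorphism_def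
    using bij_betw_trans[OF crystal_isomorphismD(1)[OF iso] crystal_isomorphismD(1)[OF iso']]
      crystal_isomorphism_elts[OF iso] crystal_isomorphismD(2-)[OF iso] crystal_isomorphismD(2-)[OF iso']
    by (simp add: option.map_comp)
  then show ?thesis using crystal_isomorphicI[OF B] by blast
qed

lemma crystal_isomorphic_relabel:
  assumes "crystal n B" and "\<And>b. b \<in> elts B \<Longrightarrow> h (g b) = b"
  shows "crystal_isomorphic n B (relabel g h B)"
proof (rule crystal_isomorphicI[OF assms(1), where \<psi> = g])
  have "bij_betw g (elts B) (g ` elts B)"
    using assms(2) by (intro inj_on_imp_bij_betw) (metis inj_onI)
  then show "crystal_isomorphism n g B (relabel g h B)"
    using assms(2) by (auto simp: crystal_isomorphism_def relabel_def)
qed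

text \<open>Made for the R-matrix, which is given by the existence of counters rather than by a
  formula: totality and uniqueness on both sides turn the relation into a bijection.\<close>

lemma crystal_isomorphic_if_rel:
  assumes B: "crystal n B" and C: "crystal n C"
    and total: "\<And>b. b \<in> elts B \<Longrightarrow> \<exists>c\<in>elts C. Q b c" "\<And>c. c \<in> elts C \<Longrightarrow> \<exists>b\<in>elts B. Q b c"
    and unique: "\<And>b c c'. \<lbrakk>b \<in> elts B; c \<in> elts C; c' \<in> elts C; Q b c; Q b c'\<rbrakk> \<Longrightarrow> c = c'"
      "\<And>b b' c. \<lbrakk>b \<in> elts B; b' \<in> elts B; c \<in> elts C; Q b c; Q b' c\<rbrakk> \<Longrightarrow> b = b'"
    and wt: "\<And>b c. \<lbrakk>b \<in> elts B; c \<in> elts C; Q b c\<rbrakk> \<Longrightarrow> wt C c = wt B b"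
    and eps_phi: "\<And>i b c. \<lbrakk>i < n; b \<in> elts B; c \<in> elts C; Q b c\<rbrakk> \<Longrightarrow>
      eps C i c = eps B i b \<and> phi C i c = phi B i b"
    and f: "\<And>i b c. \<lbrakk>i < n; b \<in> elts B; c \<in> elts C; Q b c\<rbrakk> \<Longrightarrow>
      rel_option Q (f_op B i b) (f_op C i c)"
  shows "crystal_isomorphic n B C"
proof -
  obtain \<psi> where \<psi>: "\<psi> b \<in> elts C" "Q b (\<psi> b)" if "b \<in> elts B" for b
    using total(1) by metis
  have bij: "bij_betw \<psi> (elts B) (elts C)"
    unfolding bij_betw_def
  proof (intro conjI inj_onI equalityI subsetI)
    fix b b' assume "b \<in> elts B" "b' \<in> elts B" "\<psi> b = \<psi> b'"
    then show "b = b'" using unique(2)[of b b' "\<psi> b"] \<psi>[of b] \<psi>(2)[of b'] by simp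
  next
    fix c assume c: "c \<in> elts C"
    then obtain b where b: "b \<in> elts B" "Q b c" using total(2) by blast
    then have "\<psi> b = c" using unique(1)[of b "\<psi> b" c] \<psi> c by simp
    then show "c \<in> \<psi> ` elts B" using b by blast
  qed (use \<psi> in auto)
  have "crystal_isomorphism n \<psi> B C"
  proof (rule crystal_isomorphism_if_f[OF B C bij])
    fix i b assume i: "i < n" and b: "b \<in> elts B"
    show "eps C i (\<psi> b) = eps B i b" "phi C i (\<psi> b) = phi B i b"
      using eps_phi[OF i b \<psi>[OF b]] by auto
    show "f_op C i (\<psi> b) = map_option \<psi> (f_op B i b)"
      using f[OF i b \<psi>[OF b]]
    proof cases
      case (Some b' c')
      have b': "b' \<in> elts B" using crystal.f_closed[OF B i b] Some by simp
      have "c' \<in> elts C" using crystal.f_closed[OF C i \<psi>(1)[OF b]] Some by simp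
      then have "c' = \<psi> b'" using unique(1)[OF b' _ _ Some(3)] \<psi>[OF b'] by simp
      then show ?thesis using Some by simp
    qed simp
  next
    fix b assume "b \<in> elts B"
    then show "wt C (\<psi> b) = wt B b" using wt \<psi> by simp
  qed
  then show ?thesis using B by (rule crystal_isomorphicI[rotated])
qed

section \<open>Tensor products of two and three crystals\<close>

lemma pairing_add: "pairing i (\<mu> + \<nu>) = pairing i \<mu> + pairing i \<nu>"
  by (simp add: pairing_def lookup_add)

lemma pairing_diff: "pairing i (\<mu> - \<nu>) = pairing i \<mu> - pairing i \<nu>"
  by (simp add: pairing_def lookup_minus)

text \<open>The pairing with the weight is phi - eps, and f_i lowers it by 2 while subtracting
  \<open>alpha n i\<close> from the weight.\<close>

lemma pairing_alpha_if_f: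
  assumes B: "crystal n B" and b: "i < n" "b \<in> elts B" "f_op B i b = Some b'"
  shows "pairing i (alpha n i) = 2"
proof -
  have "pairing i (wt B b') = pairing i (wt B b) - pairing i (alpha n i)"
    using crystal.f_shift[OF B b] by (simp add: pairing_diff)
  then show ?thesis
    using crystal.f_shift[OF B b] crystal.phi_eps[OF B b(1,2)]
      crystal.phi_eps[OF B b(1) crystal.f_closed[OF B b]] by linarith
qed

lemma tensor_simps:
  "elts (tensor B C) = elts B \<times> elts C"
  "e_op (tensor B C) i (b, c) =
     (if eps B i b > phi C i c then map_option (\<lambda>b'. (b', c)) (e_op B i b)
      else map_option (\<lambda>c'. (b, c')) (e_op C i c))"
  "f_op (tensor B C) i (b, c) =
     (if eps B i b \<ge> phi C i c then map_option (\<lambda>b'. (b', c)) (f_op B i b)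
      else map_option (\<lambda>c'. (b, c')) (f_op C i c))"
  "eps (tensor B C) i (b, c) = max (eps C i c) (eps B i b - pairing i (wt C c))"
  "phi (tensor B C) i (b, c) = max (phi B i b) (phi C i c + pairing i (wt B b))"
  "wt (tensor B C) (b, c) = wt B b + wt C c"
  by (simp_all add: tensor_def)

lemma crystal_tensor:
  assumes B: "crystal n B" and C: "crystal n C"
  shows "crystal n (tensor B C)"
proof (rule crystalI, goal_cases)
  case (1 p)
  then show ?case
    using crystal.wt_support[OF B] crystal.wt_support[OF C] Poly_Mapping.keys_add
    by (cases p) (fastforce simp: tensor_simps)
next
  case (2 i p)
  then show ?case
    using crystal.phi_eps[OF B] crystal.phi_eps[OF C]
    by (cases p) (auto simp: tensor_simps pairing_add)
next
  case (3 i p p')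
  then show ?case
    by (cases p) (auto simp: tensor_simps split: if_splits
        dest: crystal.e_closed[OF B \<open>i < n\<close>, rotated] crystal.e_closed[OF C \<open>i < n\<close>, rotated])
next
  case (4 i p p')
  then show ?case
    by (cases p) (auto simp: tensor_simps split: if_splits
        dest: crystal.f_closed[OF B \<open>i < n\<close>, rotated] crystal.f_closed[OF C \<open>i < n\<close>, rotated])
next
  case (5 i p p')
  obtain b c where p: "p = (b, c)" "b \<in> elts B" "c \<in> elts C" using 5 by (auto simp: tensor_simps)
  note pe = crystal.phi_eps[OF B \<open>i < n\<close> p(2)] crystal.phi_eps[OF C \<open>i < n\<close> p(3)]
  \<comment> \<open>The case distinction also decides both maxima: as phi is eps plus the pairing,
    eps of \<open>b\<close> is at least phi of \<open>c\<close> exactly if the term of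
    \<open>b\<close> dominates in \<open>eps\<close> and in \<open>phi\<close> of the pair.\<close>
  show ?case
  proof (cases "eps B i b \<ge> phi C i c")
    case True
    then obtain b' where b': "f_op B i b = Some b'" "p' = (b', c)"
      using 5 p by (auto simp: tensor_simps)
    then show ?thesis
      using crystal.f_shift[OF B \<open>i < n\<close> p(2) b'(1)] pe True
        pairing_alpha_if_f[OF B \<open>i < n\<close> p(2) b'(1)]
      by (simp add: p(1) tensor_simps pairing_diff)
  next
    case False
    then obtain c' where c': "f_op C i c = Some c'" "p' = (b, c')"
      using 5 p by (auto simp: tensor_simps)
    then show ?thesis
      using crystal.f_shift[OF C \<open>i < n\<close> p(3) c'(1)] pe False
        pairing_alpha_if_f[OF C \<open>i < n\<close> p(3) c'(1)]
      by (simp add: p(1) tensor_simps pairing_diff)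
  qed
next
  case (6 i p p')
  obtain b c b' c' where p: "p = (b, c)" "b \<in> elts B" "c \<in> elts C" "p' = (b', c')" "b' \<in> elts B" "c' \<in> elts C"
    using 6 by (auto simp: tensor_simps)
  note inv = crystal.e_f_inverse[OF B \<open>i < n\<close> p(2,5)] crystal.e_f_inverse[OF C \<open>i < n\<close> p(3,6)]
  \<comment> \<open>After f_i has acted on the left, the weak inequality has become strict; after it
    has acted on the right, the strict one has become weak. Hence the rule for e_i selects the
    factor that f_i has just changed.\<close>
  have "eps B i b' = eps B i b + 1" if "f_op B i b = Some b'"
    using crystal.f_shift[OF B \<open>i < n\<close> p(2) that] by simp
  moreover have "phi C i c' = phi C i c - 1" if "f_op C i c = Some c'"
    using crystal.f_shift[OF C \<open>i < n\<close> p(3) that] by simp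
  ultimately show ?case
    using inv by (auto simp: p(1,4) tensor_simps)
qed

lemma tensor_cong:
  assumes "crystal_isomorphic n B B'" "crystal_isomorphic n C C'"
  shows "crystal_isomorphic n (tensor B C) (tensor B' C')"
proof -
  from assms obtain \<psi> \<chi> where B: "crystal n B" "crystal n C"
    and iso: "crystal_isomorphism n \<psi> B B'" and iso': "crystal_isomorphism n \<chi> C C'"
    by (auto simp: crystal_isomorphic_def)
  have "crystal_isomorphism n (map_prod \<psi> \<chi>) (tensor B C) (tensor B' C')"
    unfolding crystal_isomorphism_def
    using bij_betw_map_prod[OF crystal_isomorphismD(1)[OF iso] crystal_isomorphismD(1)[OF iso']]
      crystal_isomorphismD(2-)[OF iso] crystal_isomorphismD(2-)[OF iso']
    by (auto simp: tensor_simps option.map_comp comp_def)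
  then show ?thesis using crystal_isomorphicI[OF crystal_tensor[OF B]] by blast
qed

text \<open>Writing phi as eps plus the pairing turns the nested conditions of both bracketings into
  the same comparisons among the three factors.\<close>

lemma tensor_assoc:
  assumes B: "crystal n B" and C: "crystal n C" and D: "crystal n D"
  shows "crystal_isomorphic n (tensor B (tensor C D)) (tensor (tensor B C) D)"
proof (rule crystal_isomorphicI, intro crystal_tensor B C D)
  let ?\<psi> = "\<lambda>(b, c, d). ((b, c), d)"
  have "bij_betw ?\<psi> (elts B \<times> elts C \<times> elts D) ((elts B \<times> elts C) \<times> elts D)"
    by (rule bij_betw_byWitness[where f' = "\<lambda>((b, c), d). (b, c, d)"]) auto
  moreover
  { fix i b c d
    assume i: "i < n" and el: "b \<in> elts B" "c \<in> elts C" "d \<in> elts D"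
    note pe = crystal.phi_eps[OF B i el(1)] crystal.phi_eps[OF C i el(2)] crystal.phi_eps[OF D i el(3)]
    have "e_op (tensor (tensor B C) D) i ((b, c), d) =
        map_option ?\<psi> (e_op (tensor B (tensor C D)) i (b, c, d))"
      using pe by (simp add: tensor_simps option.map_comp comp_def)
    moreover have "f_op (tensor (tensor B C) D) i ((b, c), d) =
        map_option ?\<psi> (f_op (tensor B (tensor C D)) i (b, c, d))"
      using pe by (simp add: tensor_simps option.map_comp comp_def)
    moreover have "eps (tensor (tensor B C) D) i ((b, c), d) = eps (tensor B (tensor C D)) i (b, c, d)"
      by (simp add: tensor_simps pairing_add)
    moreover have "phi (tensor (tensor B C) D) i ((b, c), d) = phi (tensor B (tensor C D)) i (b, c, d)"
      by (simp add: tensor_simps pairing_add)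
    moreover note calculation }
  ultimately show "crystal_isomorphism n ?\<psi> (tensor B (tensor C D)) (tensor (tensor B C) D)"
    unfolding crystal_isomorphism_def by (auto simp: tensor_simps(1,6) add.assoc)
qed

section \<open>Iterated tensor products\<close>

lemma tensor_list_Cons:
  assumes "crystal n B" "crystal n (tensor_list Bs)" "Bs \<noteq> []"
  shows "crystal_isomorphic n (tensor B (tensor_list Bs)) (tensor_list (B # Bs))"
proof -
  obtain C Cs where "Bs = C # Cs" using assms(3) by (cases Bs) auto
  then show ?thesis
    using crystal_isomorphic_relabel[OF crystal_tensor[OF assms(1,2)],
        of "\<lambda>xs. (hd xs, tl xs)" "\<lambda>(b, bs). b # bs"] by auto
qed

lemma tensor_list_single:
  assumes "crystal n B"
  shows "crystal_isomorphic n B (tensor_list [B])"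
  using crystal_isomorphic_relabel[OF assms, of hd "\<lambda>b. [b]"] by simp

lemma crystal_tensor_list:
  assumes "\<forall>B\<in>set Bs. crystal n B" "Bs \<noteq> []"
  shows "crystal n (tensor_list Bs)"
  using assms
proof (induction Bs)
  case (Cons B Bs)
  then show ?case
    using tensor_list_Cons[of n B Bs] tensor_list_single[of n B]
    by (cases "Bs = []") (auto simp: crystal_isomorphic_def)
qed simp

lemma tensor_list_Cons_cong:
  assumes "crystal n B" "crystal_isomorphic n (tensor_list Bs) (tensor_list Cs)" "Bs \<noteq> []" "Cs \<noteq> []"
  shows "crystal_isomorphic n (tensor_list (B # Bs)) (tensor_list (B # Cs))"
proof -
  have cr: "crystal n (tensor_list Bs)" "crystal n (tensor_list Cs)"
    using assms(2) by (auto simp: crystal_isomorphic_def)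
  note crystal_isomorphic_sym[OF tensor_list_Cons[OF assms(1) cr(1) assms(3)]]
  also note tensor_cong[OF crystal_isomorphic_refl[OF assms(1)] assms(2)]
  also note tensor_list_Cons[OF assms(1) cr(2) assms(4)]
  finally show ?thesis .
qed

text \<open>Associativity isolates the pair of the first two factors, to which the given isomorphism
  applies. The empty tail is treated separately because the empty product has no meaning.\<close>

lemma tensor_list_swap:
  assumes BC: "crystal_isomorphic n (tensor B C) (tensor C B)"
    and B: "crystal n B" and C: "crystal n C" and Ds: "\<forall>D\<in>set Ds. crystal n D"
  shows "crystal_isomorphic n (tensor_list (B # C # Ds)) (tensor_list (C # B # Ds))"
proof (cases "Ds = []")
  case True
  have *: "crystal_isomorphic n (tensor B C) (tensor_list [B, C])"
    if "crystal n B" "crystal n C" for B C :: "'a crystal_data"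
  proof -
    have "crystal_isomorphic n C (tensor_list [C])" using that(2) by (rule tensor_list_single)
    then have "crystal_isomorphic n (tensor B C) (tensor B (tensor_list [C]))"
      using tensor_cong crystal_isomorphic_refl that(1) by blast
    also have "crystal_isomorphic n (tensor B (tensor_list [C])) (tensor_list [B, C])"
      using that crystal_tensor_list[of "[C]"] by (intro tensor_list_Cons) auto
    finally show ?thesis .
  qed
  note crystal_isomorphic_sym[OF *[OF B C]]
  also note BC
  also note *[OF C B]
  finally show ?thesis using True by simp
next
  case False
  define D where "D = tensor_list Ds"
  have D: "crystal n D" unfolding D_def using Ds False by (rule crystal_tensor_list)
  have *: "crystal_isomorphic n (tensor (tensor B C) D) (tensor_list (B # C # Ds))"
    if B: "crystal n B" and C: "crystal n C" for B C :: "'a crystal_data"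
  proof -
    have CD: "crystal_isomorphic n (tensor C D) (tensor_list (C # Ds))"
      using tensor_list_Cons[OF C, of Ds] False D by (simp add: D_def)
    note crystal_isomorphic_sym[OF tensor_assoc[OF B C D]]
    also note tensor_cong[OF crystal_isomorphic_refl[OF B] CD]
    also have "crystal_isomorphic n (tensor B (tensor_list (C # Ds))) (tensor_list (B # C # Ds))"
      using CD B by (intro tensor_list_Cons) (auto simp: crystal_isomorphic_def)
    finally show ?thesis .
  qed
  note crystal_isomorphic_sym[OF *[OF B C]]
  also note tensor_cong[OF BC crystal_isomorphic_refl[OF D]]
  also note *[OF C B]
  finally show ?thesis .
qed

section \<open>The crystals $B^{1,s}$\<close>

lemma nxt_less: "i < n \<Longrightarrow> nxt n i < n"
  by (simp add: nxt_def)

lemma prv_less: "i < n \<Longrightarrow> prv n i < n"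
  by (simp add: prv_def)

lemma nxt_eq: "i < n \<Longrightarrow> nxt n i = (if Suc i = n then 0 else Suc i)"
  by (simp add: nxt_def)

lemma prv_eq: "i < n \<Longrightarrow> prv n i = (if i = 0 then n - 1 else i - 1)"
  by (cases i) (auto simp: prv_def)

lemma nxt_prv: "i < n \<Longrightarrow> nxt n (prv n i) = i"
  using nxt_eq[OF prv_less, of i n] by (auto simp: prv_eq)

lemma prv_nxt: "i < n \<Longrightarrow> prv n (nxt n i) = i"
  using prv_eq[OF nxt_less, of i n] by (auto simp: nxt_eq split: if_splits)

lemma nxt_eq_iff: "\<lbrakk>i < n; k < n\<rbrakk> \<Longrightarrow> nxt n i = k \<longleftrightarrow> i = prv n k"
  using nxt_prv prv_nxt by metis

lemma nxt_inj: "\<lbrakk>i < n; k < n\<rbrakk> \<Longrightarrow> nxt n i = nxt n k \<longleftrightarrow> i = k"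
  using prv_nxt by metis

lemma nxt_neq: "\<lbrakk>i < n; n \<ge> 2\<rbrakk> \<Longrightarrow> nxt n i \<noteq> i"
  by (auto simp: nxt_eq)

lemma prv_neq: "\<lbrakk>i < n; n \<ge> 2\<rbrakk> \<Longrightarrow> prv n i \<noteq> i"
  by (auto simp: prv_eq)

lemma prv_neq_nxt: "\<lbrakk>i < n; n \<ge> 3\<rbrakk> \<Longrightarrow> prv n i \<noteq> nxt n i"
  by (auto simp: prv_eq nxt_eq split: if_splits)

lemma sum_nxt: "(\<Sum>i<n. g (nxt n i)) = (\<Sum>i<n. g i)"
  by (rule sum.reindex_bij_witness[where i = "prv n" and j = "nxt n"])
     (auto simp: nxt_prv prv_nxt nxt_less prv_less)

text \<open>The vector that f_i produces if \<open>x i\<close> is nonzero. If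
  \<open>x i = 0\<close>, truncated subtraction would spoil the sum of the entries.\<close>

definition move :: "nat \<Rightarrow> nat \<Rightarrow> (nat \<Rightarrow> nat) \<Rightarrow> nat \<Rightarrow> nat" where
  "move n i x = x(i := x i - 1, nxt n i := x (nxt n i) + 1)"

lemma sum_move:
  assumes "i < n" "n \<ge> 2" "x i \<noteq> 0"
  shows "(\<Sum>k<n. move n i x k) = (\<Sum>k<n. x k)"
proof -
  have ne: "nxt n i \<noteq> i" using assms nxt_neq by auto
  have split: "(\<Sum>k<n. g k) = g i + g (nxt n i) + (\<Sum>k\<in>{..<n} - {i} - {nxt n i}. g k)"
    for g :: "nat \<Rightarrow> nat"
    using assms ne nxt_less[of i n]
    by (simp add: sum.remove[of "{..<n}" i] sum.remove[of "{..<n} - {i}" "nxt n i"])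
  show ?thesis
    using assms(3) ne by (simp add: split[of x] split[of "move n i x"]) (simp add: move_def)
qed

lemma KR_simps:
  "x \<in> elts (KR_crystal n s) \<longleftrightarrow> (\<forall>i\<ge>n. x i = 0) \<and> (\<Sum>i<n. x i) = s"
  "eps (KR_crystal n s) i x = int (x (nxt n i))"
  "phi (KR_crystal n s) i x = int (x i)"
  "f_op (KR_crystal n s) i x = (if x i = 0 then None else Some (move n i x))"
  by (simp_all add: KR_crystal_def move_def)

lemma lookup_KR_wt:
  "Poly_Mapping.lookup (wt (KR_crystal n s) x) k = (if k < n then int (x k) - int (x (nxt n k)) else 0)"
  by (simp add: KR_crystal_def lookup_sum lookup_single when_def)

lemma pairing_KR_wt:
  "i < n \<Longrightarrow> pairing i (wt (KR_crystal n s) x) = int (x i) - int (x (nxt n i))"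
  by (simp add: pairing_def lookup_KR_wt)

lemma lookup_alpha:
  "Poly_Mapping.lookup (alpha n i) k =
     2 * of_bool (k = i) - of_bool (k = prv n i) - of_bool (k = nxt n i)"
  unfolding alpha_def Lam_def lookup_minus lookup_add by (auto simp: lookup_single)

lemma crystal_KR:
  assumes n: "n \<ge> 3"
  shows "crystal n (KR_crystal n s)"
proof (rule crystalI, goal_cases)
  case (1 x)
  then show ?case by (auto simp: in_keys_iff lookup_KR_wt split: if_splits)
next
  case (2 i x)
  then show ?case by (simp add: KR_simps pairing_KR_wt)
next
  case (3 i x x')
  then have x: "x (nxt n i) \<noteq> 0" "x' = x(i := x i + 1, nxt n i := x (nxt n i) - 1)"
    by (auto simp: KR_crystal_def split: if_splits)
  \<comment> \<open>Closure under e_i is reduced to the invariance of the sum under f_i, read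
    backwards.\<close>
  have "x = move n i x'" using x nxt_neq[of i n] 3 n by (auto simp: move_def fun_eq_iff)
  moreover have "x' i \<noteq> 0" using x nxt_neq[of i n] 3 n by auto
  ultimately have "(\<Sum>k<n. x' k) = s"
    using sum_move[of i n x'] 3 n by (simp add: KR_simps)
  then show ?case using 3 x nxt_less[of i n] by (auto simp: KR_simps)
next
  case (4 i x x')
  then show ?case
    using n sum_move[of i n x] nxt_less[of i n]
    by (auto simp: KR_simps move_def split: if_splits)
next
  case (5 i x x')
  then have x: "x i \<noteq> 0" "x' = move n i x"
    by (auto simp: KR_simps split: if_splits)
  have ne: "nxt n i \<noteq> i" "prv n i \<noteq> i" "prv n i \<noteq> nxt n i"
    using nxt_neq prv_neq prv_neq_nxt 5 n by auto
  have "wt (KR_crystal n s) x' = wt (KR_crystal n s) x - alpha n i"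
  proof (rule poly_mapping_eqI)
    fix k
    \<comment> \<open>The coefficient at \<open>k\<close> depends on \<open>x k\<close> and
      \<open>x (nxt n k)\<close>, so it can change only at \<open>prv n i\<close>, \<open>i\<close>
      and \<open>nxt n i\<close>; these are distinct because n is at least 3.\<close>
    have "nxt n k = i \<longleftrightarrow> k = prv n i" "nxt n k = nxt n i \<longleftrightarrow> k = i" if "k < n"
      using nxt_eq_iff nxt_inj 5 that by auto
    then show "Poly_Mapping.lookup (wt (KR_crystal n s) x') k =
        Poly_Mapping.lookup (wt (KR_crystal n s) x - alpha n i) k"
      using x ne nxt_less[of i n] prv_less[of i n] 5
      by (auto simp: lookup_KR_wt lookup_minus lookup_alpha move_def)
  qed
  then show ?case using x ne by (auto simp: KR_simps move_def)
next
  case (6 i x x')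
  then show ?case
    using nxt_neq[of i n] n by (auto simp: KR_crystal_def fun_eq_iff)
qed

section \<open>The combinatorial R-matrix\<close>

text \<open>Each unit of \<open>y i\<close> is matched with a unit of \<open>x k\<close>, where
  \<open>k\<close> is searched cyclically from \<open>nxt n i\<close> on; \<open>r k\<close> units are still waiting after position \<open>k\<close>,
  and the \<open>u k\<close> unmatched units of \<open>x k\<close> move to the other factor.\<close>

definition R_matrix ::
    "nat \<Rightarrow> (nat \<Rightarrow> nat) \<times> (nat \<Rightarrow> nat) \<Rightarrow> (nat \<Rightarrow> nat) \<times> (nat \<Rightarrow> nat) \<Rightarrow> bool" where
  "R_matrix n = (\<lambda>(x, y) (x', y'). \<exists>r u. \<forall>i<n. (r i = 0 \<or> u i = 0) \<and>
     r (nxt n i) + x (nxt n i) = r i + y i + u (nxt n i) \<and> x i = x' i + u i \<and> y' i = y i + u i)"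

lemma R_matrixE:
  assumes "R_matrix n (x, y) (x', y')"
  obtains r u where "\<And>i. i < n \<Longrightarrow> r i = 0 \<or> u i = 0"
    and "\<And>i. i < n \<Longrightarrow> r (nxt n i) + x (nxt n i) = r i + y i + u (nxt n i)"
    and "\<And>i. i < n \<Longrightarrow> x i = x' i + u i" and "\<And>i. i < n \<Longrightarrow> y' i = y i + u i"
proof -
  obtain r u where w: "\<forall>i<n. (r i = 0 \<or> u i = 0) \<and>
     r (nxt n i) + x (nxt n i) = r i + y i + u (nxt n i) \<and> x i = x' i + u i \<and> y' i = y i + u i"
    using assms unfolding R_matrix_def prod.case by (elim exE)
  show ?thesis by (rule that[of r u]) (use w in simp_all)
qed

lemma R_matrixI:
  assumes "\<And>i. i < n \<Longrightarrow> r i = 0 \<or> u i = 0"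
    and "\<And>i. i < n \<Longrightarrow> r (nxt n i) + x (nxt n i) = r i + y i + u (nxt n i)"
    and "\<And>i. i < n \<Longrightarrow> x i = x' i + u i" and "\<And>i. i < n \<Longrightarrow> y' i = y i + u i"
  shows "R_matrix n (x, y) (x', y')"
  unfolding R_matrix_def prod.case by (intro exI[of _ r] exI[of _ u] allI impI conjI assms)

text \<open>Around the circle the waiting units cancel. So every unit of \<open>y\<close> is
  matched, and the number of unmatched units of \<open>x\<close> is the difference of the sizes;
  moving them exchanges the sizes of the two vectors.\<close>

lemma R_matrix_sum_u:
  fixes x y r u :: "nat \<Rightarrow> nat"
  assumes "\<And>i. i < n \<Longrightarrow> r (nxt n i) + x (nxt n i) = r i + y i + u (nxt n i)"
  shows "(\<Sum>i<n. x i) = (\<Sum>i<n. y i) + (\<Sum>i<n. u i)"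
proof -
  have "(\<Sum>i<n. r (nxt n i) + x (nxt n i)) = (\<Sum>i<n. r i + y i + u (nxt n i))"
    using assms by (intro sum.cong) auto
  then show ?thesis by (simp add: sum.distrib sum_nxt)
qed

text \<open>The counter \<open>r\<close> itself need not be unique: if \<open>u\<close> vanishes,
  any constant may be added to it. But if one counter starts below another, it stays below all
  around the circle, and then its \<open>u\<close> is pointwise at least the other one. As both have
  the same sum, they agree.\<close>

lemma R_matrix_unique:
  assumes R: "R_matrix n (x, y) (x', y')" and R': "R_matrix n (x, y) (x'', y'')" and i: "i < n"
  shows "x' i = x'' i \<and> y' i = y'' i"
proof -
  obtain r u where r: "\<And>i. i < n \<Longrightarrow> r i = 0 \<or> u i = 0"
    "\<And>i. i < n \<Longrightarrow> r (nxt n i) + x (nxt n i) = r i + y i + u (nxt n i)"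
    "\<And>i. i < n \<Longrightarrow> x i = x' i + u i" "\<And>i. i < n \<Longrightarrow> y' i = y i + u i"
    using R by (rule R_matrixE) blast
  obtain r' u' where r': "\<And>i. i < n \<Longrightarrow> r' i = 0 \<or> u' i = 0"
    "\<And>i. i < n \<Longrightarrow> r' (nxt n i) + x (nxt n i) = r' i + y i + u' (nxt n i)"
    "\<And>i. i < n \<Longrightarrow> x i = x'' i + u' i" "\<And>i. i < n \<Longrightarrow> y'' i = y i + u' i"
    using R' by (rule R_matrixE) blast
  have *: "u i = u' i" if i: "i < n" and le: "r 0 \<le> r' 0"
    and r: "\<And>i. i < n \<Longrightarrow> r i = 0 \<or> u i = 0"
      "\<And>i. i < n \<Longrightarrow> r (nxt n i) + x (nxt n i) = r i + y i + u (nxt n i)"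
    and r': "\<And>i. i < n \<Longrightarrow> r' i = 0 \<or> u' i = 0"
      "\<And>i. i < n \<Longrightarrow> r' (nxt n i) + x (nxt n i) = r' i + y i + u' (nxt n i)"
    for r u r' u' :: "nat \<Rightarrow> nat" and i
  proof -
    \<comment> \<open>By complementarity, \<open>r (nxt n k)\<close> and \<open>u (nxt n k)\<close>
      are the positive and the negative part of \<open>r k + y k - x (nxt n k)\<close>, hence
      monotone and antitone in \<open>r k\<close>.\<close>
    have mono: "r (nxt n k) \<le> r' (nxt n k)" "u' (nxt n k) \<le> u (nxt n k)" if "k < n" "r k \<le> r' k" for k
      using that r(1)[OF nxt_less] r(2)[of k] r'(1)[OF nxt_less] r'(2)[of k] by fastforce+
    have r_le: "r k \<le> r' k" if "k < n" for k
      using that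
    proof (induction k)
      case (Suc k)
      then show ?case using mono(1)[of k] by (simp add: nxt_eq)
    qed (use le in simp)
    have u_le: "u' k \<le> u k" if "k < n" for k
      using mono(2)[OF prv_less r_le[OF prv_less]] that nxt_prv by simp
    have "(\<Sum>k<n. u' k) = (\<Sum>k<n. u k)"
      using R_matrix_sum_u[of n r x y u] R_matrix_sum_u[of n r' x y u'] r(2) r'(2) by simp
    then show ?thesis
      using sum_mono_inv[of u' "{..<n}" u i] u_le i by auto
  qed
  have "u i = u' i"
  proof (cases "r 0 \<le> r' 0")
    case True
    show ?thesis by (rule *[OF i True r(1,2) r'(1,2)])
  next
    case False
    then have "r' 0 \<le> r 0" by simp
    then show ?thesis using *[OF i _ r'(1,2) r(1,2)] by simp
  qed
  then show ?thesis using r(3,4)[OF i] r'(3,4)[OF i] by simp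
qed

text \<open>Reflection of the circle: it exchanges the roles of \<open>nxt\<close> and
  \<open>prv\<close>.\<close>

definition reverse :: "nat \<Rightarrow> (nat \<Rightarrow> nat) \<Rightarrow> nat \<Rightarrow> nat" where
  "reverse n x i = (if i < n then x (n - 1 - i) else 0)"

lemma sum_reverse: "(\<Sum>i<n. reverse n x i) = (\<Sum>i<n. x i)"
  by (rule sum.reindex_bij_witness[where i = "\<lambda>i. n - 1 - i" and j = "\<lambda>i. n - 1 - i"])
     (auto simp: reverse_def)

lemma reverse_reverse: "i < n \<Longrightarrow> reverse n (reverse n x) i = x i"
  by (auto simp: reverse_def)

text \<open>Matching in the opposite direction recovers the same pairs.\<close>

lemma R_matrix_reverse:
  assumes "R_matrix n (x, y) (x', y')"
  shows "R_matrix n (reverse n y', reverse n x') (reverse n y, reverse n x)"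
proof -
  obtain r u where r: "\<And>i. i < n \<Longrightarrow> r i = 0 \<or> u i = 0"
    "\<And>i. i < n \<Longrightarrow> r (nxt n i) + x (nxt n i) = r i + y i + u (nxt n i)"
    "\<And>i. i < n \<Longrightarrow> x i = x' i + u i" "\<And>i. i < n \<Longrightarrow> y' i = y i + u i"
    using assms by (rule R_matrixE) blast
  have "reverse n r (nxt n i) + reverse n y' (nxt n i) =
      reverse n r i + reverse n x' i + reverse n u (nxt n i)" if i: "i < n" for i
  proof -
    \<comment> \<open>The identity required at \<open>i\<close> is the original one at the
      reflection \<open>k\<close> of \<open>nxt n i\<close>. Rewriting \<open>x\<close> as
      \<open>x' + u\<close> and \<open>y'\<close> as \<open>y + u\<close> moves the unmatched term
      from \<open>nxt n k\<close> to \<open>k\<close>.\<close>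
    define k where "k = n - 1 - nxt n i"
    have k: "k < n" "nxt n k = n - 1 - i"
      using i by (auto simp: k_def nxt_eq)
    then have k': "nxt n k < n" by simp
    show ?thesis
      using r(2)[OF k(1)] r(3)[OF k'] r(4)[OF k(1)] i nxt_less[OF i]
      unfolding k(2) by (simp add: reverse_def k_def)
  qed
  moreover have "reverse n r i = 0 \<or> reverse n u i = 0"
    "reverse n y' i = reverse n y i + reverse n u i" "reverse n x i = reverse n x' i + reverse n u i"
    if "i < n" for i
    using r[of "n - 1 - i"] that by (auto simp: reverse_def)
  ultimately show ?thesis
    by (intro R_matrixI[of n "reverse n r" "reverse n u"]) auto
qed

text \<open>The counter is found by walking around the circle twice: \<open>t\<close> is the number
  of waiting units, starting from none, and truncated subtraction discards the unmatched units of
  \<open>x\<close>. After the first round the walk is periodic, so its second round serves as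
  \<open>r\<close>.\<close>

lemma R_matrix_exists:
  assumes le: "(\<Sum>i<n. y i) \<le> (\<Sum>i<n. x i)"
  shows "\<exists>x' y'. (\<forall>i\<ge>n. x' i = 0 \<and> y' i = 0) \<and> R_matrix n (x, y) (x', y')"
proof -
  define t where "t = rec_nat 0 (\<lambda>k tk. tk + y (k mod n) - x (Suc k mod n))"
  have t: "t 0 = 0" "t (Suc k) = t k + y (k mod n) - x (Suc k mod n)" for k
    by (simp_all add: t_def)
  have t_add: "t (n + Suc k) = t (n + k) + y (k mod n) - x (Suc k mod n)" for k
    using t(2)[of "n + k"] by (simp flip: add_Suc_right)
  have mono: "t k \<le> t (n + k)" for k
    by (induction k) (use t t_add in \<open>auto intro!: diff_le_mono\<close>)
  have stays: "t (n + (k + l)) = t (k + l)" if "t (n + k) = t k" for k l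
  proof (induction l)
    case (Suc l)
    then show ?case using t(2)[of "k + l"] t_add[of "k + l"] by simp
  qed (use that in simp)
  have periodic: "t (n + n) = t n"
  proof (rule ccontr)
    assume neq: "t (n + n) \<noteq> t n"
    \<comment> \<open>If the second round did not end where it began, it would stay strictly above
      the first one and hence be positive. Then no subtraction is truncated, so the counter changes
      by the difference of the sizes, which is at most 0 and contradicts
      \<open>mono\<close>.\<close>
    have pos: "0 < t (n + k)" if "k \<le> n" for k
    proof -
      have "t (n + k) \<noteq> t k" using stays[of k "n - k"] neq that by auto
      then show ?thesis using mono[of k] by linarith
    qed
    have "k \<le> n \<Longrightarrow> t (n + k) + (\<Sum>l<k. x (nxt n l)) = t n + (\<Sum>l<k. y l)" for k
    proof (induction k)
      case (Suc k)
      then show ?case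
        using pos[of "Suc k"] t_add[of k] by (simp add: nxt_def)
    qed simp
    from this[of n] have "t (n + n) + (\<Sum>l<n. x l) = t n + (\<Sum>l<n. y l)"
      by (simp add: sum_nxt)
    then show False using le mono[of n] neq by simp
  qed
  define r where "r i = t (n + i)" for i
  have r_nxt: "r (nxt n i) = r i + y i - x (nxt n i)" if "i < n" for i
  proof (cases "Suc i = n")
    case True
    then have "r (nxt n i) = t (n + Suc i)" using periodic by (simp add: r_def nxt_def)
    then show ?thesis using t_add[of i] that by (simp add: r_def nxt_def)
  next
    case False
    then have "nxt n i = Suc i" using that by (simp add: nxt_eq)
    then show ?thesis using t_add[of i] that False by (simp add: r_def)
  qed
  \<comment> \<open>The amount cut off by the truncated subtraction at \<open>i\<close>; the units
    arriving there have left \<open>prv n i\<close>.\<close>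
  define u where "u i = x i - (r (prv n i) + y (prv n i))" for i
  have u_nxt: "u (nxt n i) = x (nxt n i) - (r i + y i)" if "i < n" for i
    using that by (simp add: u_def prv_nxt)
  have "r i = 0 \<or> u i = 0" if "i < n" for i
    using r_nxt[OF prv_less[OF that]] nxt_prv[OF that] by (auto simp: u_def)
  moreover have "r (nxt n i) + x (nxt n i) = r i + y i + u (nxt n i)" if "i < n" for i
    using r_nxt[OF that] u_nxt[OF that] by simp
  moreover have "u i \<le> x i" for i by (simp add: u_def)
  ultimately have "R_matrix n (x, y)
      (\<lambda>i. if i < n then x i - u i else 0, \<lambda>i. if i < n then y i + u i else 0)"
    by (intro R_matrixI[of n r u]) (auto simp: nxt_less)
  then show ?thesis
    by (intro exI conjI) auto
qed

text \<open>Only the matching between the positions \<open>i\<close> and \<open>nxt n i\<close> is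
  affected by f_i, so the counters for the new pair differ from the old ones in at most one unit at
  each of these positions.\<close>

lemma R_matrix_f:
  assumes R: "R_matrix n (x, y) (x', y')" and i: "i < n" and n: "n \<ge> 2"
  shows "rel_option (R_matrix n) (f_op (tensor (KR_crystal n s) (KR_crystal n s')) i (x, y))
    (f_op (tensor (KR_crystal n s') (KR_crystal n s)) i (x', y'))"
proof -
  obtain r u where r: "\<And>i. i < n \<Longrightarrow> r i = 0 \<or> u i = 0"
    "\<And>i. i < n \<Longrightarrow> r (nxt n i) + x (nxt n i) = r i + y i + u (nxt n i)"
    "\<And>i. i < n \<Longrightarrow> x i = x' i + u i" "\<And>i. i < n \<Longrightarrow> y' i = y i + u i"
    using R by (rule R_matrixE) blast
  have i': "nxt n i < n" "nxt n i \<noteq> i" using i n nxt_less nxt_neq by auto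
  have nxt: "nxt n k = nxt n i \<longleftrightarrow> k = i" if "k < n" for k
    using nxt_inj i that by auto
  note at_i = r(1)[OF i] r(2)[OF i] r(3)[OF i] r(4)[OF i] r(1)[OF i'(1)] r(3)[OF i'(1)] r(4)[OF i'(1)]
  \<comment> \<open>The two letters of a case name tell whether f_i acts on the left factor (x) or
    on the right one (y), before and after the exchange.\<close>
  consider (xx) "y i \<le> x (nxt n i)" "u i = 0" | (xy) "y i \<le> x (nxt n i)" "u i \<noteq> 0"
    | (yy) "x (nxt n i) < y i" by linarith
  then show ?thesis
  proof cases
    case xx
    have "y' i \<le> x' (nxt n i)" "x i = x' i" using at_i xx by auto
    \<comment> \<open>No unit of \<open>x i\<close> is unmatched. The partner of the unit that
      leaves now waits one position longer, so \<open>r i\<close> grows.\<close>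
    moreover have "R_matrix n (move n i x, y) (move n i x', y')" if "x i \<noteq> 0"
    proof (rule R_matrixI[of n "r(i := r i + 1)" "u"], goal_cases)
      case (1 k)
      then show ?case using r(1)[of k] nxt[of k] i' at_i xx that by (auto simp: move_def)
    next
      case (2 k)
      then show ?case using r(2)[of k] nxt[of k] i' at_i xx that by (auto simp: move_def)
    next
      case (3 k)
      then show ?case using r(3)[of k] nxt[of k] i' at_i xx that by (auto simp: move_def)
    next
      case (4 k)
      then show ?case using r(4)[of k] nxt[of k] i' at_i xx that by (auto simp: move_def)
    qed
    ultimately show ?thesis using xx by (simp add: tensor_simps KR_simps)
  next
    case xy
    have "x' (nxt n i) < y' i" "x i \<noteq> 0" and r_0: "r i = 0" "r (nxt n i) = 0" using at_i xy by auto
    \<comment> \<open>An unmatched unit of \<open>x i\<close> moves on and remains unmatched,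
      because nothing is waiting at either position. After the exchange it belongs to
      \<open>y'\<close>.\<close>
    moreover have "R_matrix n (move n i x, y) (x', move n i y')"
    proof (rule R_matrixI[of n "r" "u(i := u i - 1, nxt n i := u (nxt n i) + 1)"], goal_cases)
      case (1 k)
      then show ?case using r(1)[of k] nxt[of k] i' at_i xy r_0 by (auto simp: move_def)
    next
      case (2 k)
      then show ?case using r(2)[of k] nxt[of k] i' at_i xy r_0 by (auto simp: move_def)
    next
      case (3 k)
      then show ?case using r(3)[of k] nxt[of k] i' at_i xy r_0 by (auto simp: move_def)
    next
      case (4 k)
      then show ?case using r(4)[of k] nxt[of k] i' at_i xy r_0 by (auto simp: move_def)
    qed
    ultimately show ?thesis using xy by (simp add: tensor_simps KR_simps)
  next
    case yy
    have "x' (nxt n i) < y' i" and r_pos: "u (nxt n i) = 0" "r (nxt n i) \<noteq> 0" using at_i yy by auto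
    \<comment> \<open>Some unit of \<open>y i\<close> waits beyond \<open>nxt n i\<close>. It now
      starts from there, so one unit fewer is left over from before.\<close>
    moreover have "R_matrix n (x, move n i y) (x', move n i y')"
    proof (rule R_matrixI[of n "r(nxt n i := r (nxt n i) - 1)" "u"], goal_cases)
      case (1 k)
      then show ?case using r(1)[of k] nxt[of k] i' at_i yy r_pos by (auto simp: move_def)
    next
      case (2 k)
      then show ?case using r(2)[of k] nxt[of k] i' at_i yy r_pos by (auto simp: move_def)
    next
      case (3 k)
      then show ?case using r(3)[of k] nxt[of k] i' at_i yy r_pos by (auto simp: move_def)
    next
      case (4 k)
      then show ?case using r(4)[of k] nxt[of k] i' at_i yy r_pos by (auto simp: move_def)
    qed
    ultimately show ?thesis using yy by (simp add: tensor_simps KR_simps)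
  qed
qed

text \<open>The inequality guarantees that all of \<open>y\<close> finds partners. Surjectivity and
  injectivity are existence and uniqueness for the reflected pair, in which \<open>y'\<close> plays
  the role of the larger vector.\<close>

lemma KR_tensor_commute_if_le:
  assumes n: "n \<ge> 3" and le: "s' \<le> s"
  shows "crystal_isomorphic n (tensor (KR_crystal n s) (KR_crystal n s'))
    (tensor (KR_crystal n s') (KR_crystal n s))"
proof -
  have "crystal n (tensor (KR_crystal n s) (KR_crystal n s'))" for s s'
    using n by (intro crystal_tensor crystal_KR)
  note cr = this[of s s'] this[of s' s]
  have sums: "(\<Sum>i<n. x' i) = (\<Sum>i<n. y i) \<and> (\<Sum>i<n. y' i) = (\<Sum>i<n. x i)"
    if R: "R_matrix n (x, y) (x', y')" for x y x' y' :: "nat \<Rightarrow> nat"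
  proof -
    obtain r u where r: "\<And>i. i < n \<Longrightarrow> r i = 0 \<or> u i = 0"
      "\<And>i. i < n \<Longrightarrow> r (nxt n i) + x (nxt n i) = r i + y i + u (nxt n i)"
      "\<And>i. i < n \<Longrightarrow> x i = x' i + u i" "\<And>i. i < n \<Longrightarrow> y' i = y i + u i"
      using R by (rule R_matrixE) blast
    have "(\<Sum>i<n. x i) = (\<Sum>i<n. x' i) + (\<Sum>i<n. u i)" "(\<Sum>i<n. y' i) = (\<Sum>i<n. y i) + (\<Sum>i<n. u i)"
      using r(3,4) by (simp_all flip: sum.distrib)
    then show ?thesis using R_matrix_sum_u[of n r x y u] r(2) by simp
  qed
  have ext: "x = x'" if "\<forall>i\<ge>n. x i = 0" "\<forall>i\<ge>n. x' i = 0" "\<And>i. i < n \<Longrightarrow> x i = x' i"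
    for x x' :: "nat \<Rightarrow> nat"
    using that by (metis ext leI)
  show ?thesis
  proof (rule crystal_isomorphic_if_rel[OF cr, where Q = "R_matrix n"], goal_cases)
    case (1 p)
    obtain x y where p: "p = (x, y)" by (cases p)
    then obtain x' y' where "\<forall>i\<ge>n. x' i = 0 \<and> y' i = 0" "R_matrix n (x, y) (x', y')"
      using R_matrix_exists[of y n x] 1 le by (auto simp: tensor_simps KR_simps)
    then show ?case using sums 1 p by (intro bexI[of _ "(x', y')"]) (auto simp: tensor_simps KR_simps)
  next
    case (2 q)
    obtain x' y' where q: "q = (x', y')" by (cases q)
    \<comment> \<open>Match the reflections of \<open>y'\<close> and \<open>x'\<close>; reflecting
      the result once more gives a preimage of \<open>(x', y')\<close>.\<close>
    obtain a b where ab: "\<forall>i\<ge>n. a i = 0 \<and> b i = 0" "R_matrix n (reverse n y', reverse n x') (a, b)"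
      using R_matrix_exists[of "reverse n x'" n "reverse n y'"] 2 le q
      by (auto simp: tensor_simps KR_simps sum_reverse)
    have "R_matrix n (reverse n b, reverse n a) (reverse n (reverse n x'), reverse n (reverse n y'))"
      using R_matrix_reverse[OF ab(2)] .
    moreover have "reverse n (reverse n z) = z" if "\<forall>i\<ge>n. z i = 0" for z
      using that by (intro ext) (auto simp: reverse_reverse, simp add: reverse_def)
    ultimately have R: "R_matrix n (reverse n b, reverse n a) (x', y')"
      using 2 q by (auto simp: tensor_simps KR_simps)
    show ?case
      using R sums[OF R] 2 q
      by (intro bexI[of _ "(reverse n b, reverse n a)"])
        (auto simp: tensor_simps KR_simps, auto simp: reverse_def)
  next
    case (3 p q q')
    then show ?case
      using R_matrix_unique by (auto simp: tensor_simps KR_simps intro!: ext)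
  next
    case (4 p p' q)
    obtain x1 y1 x2 y2 x' y' where p: "p = (x1, y1)" "p' = (x2, y2)" "q = (x', y')"
      by (cases p, cases p', cases q)
    have "reverse n y1 i = reverse n y2 i \<and> reverse n x1 i = reverse n x2 i" if "i < n" for i
      using R_matrix_unique[OF R_matrix_reverse R_matrix_reverse] 4 p that by blast
    then have "x1 i = x2 i \<and> y1 i = y2 i" if "i < n" for i
      using that reverse_reverse[of i n] by (metis reverse_def)
    then show ?case
      using 4 p ext[of x1 x2] ext[of y1 y2] by (auto simp: tensor_simps KR_simps)
  next
    case (5 p q)
    obtain x y x' y' where p: "p = (x, y)" "q = (x', y')" by (cases p, cases q)
    have R: "R_matrix n (x, y) (x', y')" using 5 p by simp
    have "x i + y i = x' i + y' i" if "i < n" for i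
      using R by (rule R_matrixE) (use that in simp)
    then have "int (x i) + int (y i) = int (x' i) + int (y' i)" if "i < n" for i
      using that by (metis of_nat_add)
    then show ?case
      using p nxt_less
      by (auto intro!: poly_mapping_eqI simp: tensor_simps lookup_add lookup_KR_wt algebra_simps)
  next
    case (6 i p q)
    obtain x y x' y' where p: "p = (x, y)" "q = (x', y')" by (cases p, cases q)
    obtain r u where r: "\<And>i. i < n \<Longrightarrow> r i = 0 \<or> u i = 0"
      "\<And>i. i < n \<Longrightarrow> r (nxt n i) + x (nxt n i) = r i + y i + u (nxt n i)"
      "\<And>i. i < n \<Longrightarrow> x i = x' i + u i" "\<And>i. i < n \<Longrightarrow> y' i = y i + u i"
      using 6(4) unfolding p by (rule R_matrixE) blast
    have i: "i < n" "nxt n i < n" using 6 nxt_less by auto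
    \<comment> \<open>\<open>eps\<close> and \<open>phi\<close> at \<open>i\<close> involve only the
      entries at \<open>i\<close> and \<open>nxt n i\<close>, so one matching identity and
      complementarity at these two positions suffice.\<close>
    show ?case
      using r(1)[OF i(1)] r(2)[OF i(1)] r(3)[OF i(1)] r(4)[OF i(1)]
        r(1)[OF i(2)] r(3)[OF i(2)] r(4)[OF i(2)] i
      by (auto simp: p tensor_simps KR_simps pairing_KR_wt max_def)
  next
    case (7 i p q)
    then show ?case using R_matrix_f n by (cases p, cases q) auto
  qed
qed

lemma KR_tensor_commute:
  assumes "n \<ge> 3"
  shows "crystal_isomorphic n (tensor (KR_crystal n s) (KR_crystal n s'))
    (tensor (KR_crystal n s') (KR_crystal n s))"
  using KR_tensor_commute_if_le[OF assms, of s' s]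
    crystal_isomorphic_sym[OF KR_tensor_commute_if_le[OF assms, of s s']]
  by (cases "s' \<le> s") auto

section \<open>Nakajima monomials\<close>

lemma finite_levels: "finite {t. (i, t) \<in> Poly_Mapping.keys m}"
proof -
  have "{t. (i, t) \<in> Poly_Mapping.keys m} = Pair i -` Poly_Mapping.keys m" by auto
  then show ?thesis by (simp add: finite_vimageI inj_def)
qed

text \<open>Cancellation can make the support of a product smaller than the union of the supports.
  Summing over any finite superset makes the sums for \<open>m\<close>, \<open>m'\<close> and
  \<open>m + m'\<close> comparable.\<close>

lemma level_sum_superset:
  assumes "finite T" "\<And>t. t \<notin> T \<Longrightarrow> Poly_Mapping.lookup m (i, t) = 0"
  shows "(\<Sum>t | P t \<and> (i, t) \<in> Poly_Mapping.keys m. Poly_Mapping.lookup m (i, t)) =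
    (\<Sum>t\<in>T. if P t then Poly_Mapping.lookup m (i, t) else 0)"
proof -
  have "(\<Sum>t | P t \<and> (i, t) \<in> Poly_Mapping.keys m. Poly_Mapping.lookup m (i, t)) =
      (\<Sum>t | P t \<and> (i, t) \<in> Poly_Mapping.keys m. if P t then Poly_Mapping.lookup m (i, t) else 0)"
    by (rule sum.cong) auto
  also have "\<dots> = (\<Sum>t\<in>T. if P t then Poly_Mapping.lookup m (i, t) else 0)"
    using assms by (intro sum.mono_neutral_left) (auto simp: in_keys_iff)
  finally show ?thesis .
qed

lemma lower_sum_superset:
  assumes "finite T" "\<And>t. t \<notin> T \<Longrightarrow> Poly_Mapping.lookup m (i, t) = 0"
  shows "lower_sum i m k = (\<Sum>t\<in>T. if t \<le> k then Poly_Mapping.lookup m (i, t) else 0)"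
  unfolding lower_sum_def using assms by (rule level_sum_superset)

lemma upper_sum_superset:
  assumes "finite T" "\<And>t. t \<notin> T \<Longrightarrow> Poly_Mapping.lookup m (i, t) = 0"
  shows "upper_sum i m k = (\<Sum>t\<in>T. if k \<le> t then Poly_Mapping.lookup m (i, t) else 0)"
  unfolding upper_sum_def using assms by (rule level_sum_superset)

lemma level_sum_add:
  "(\<Sum>t | P t \<and> (i, t) \<in> Poly_Mapping.keys (m + m'). Poly_Mapping.lookup (m + m') (i, t)) =
   (\<Sum>t | P t \<and> (i, t) \<in> Poly_Mapping.keys m. Poly_Mapping.lookup m (i, t)) +
   (\<Sum>t | P t \<and> (i, t) \<in> Poly_Mapping.keys m'. Poly_Mapping.lookup (m' :: monomial) (i, t))"
proof -
  let ?T = "{t. (i, t) \<in> Poly_Mapping.keys m} \<union> {t. (i, t) \<in> Poly_Mapping.keys m'}"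
  have T: "finite ?T" by (simp add: finite_levels)
  show ?thesis
    by (subst (1 2 3) level_sum_superset[OF T])
      (auto simp: in_keys_iff lookup_add sum.distrib[symmetric] intro!: sum.cong)
qed

lemma lower_sum_add: "lower_sum i (m + m') k = lower_sum i m k + lower_sum i m' k"
  unfolding lower_sum_def by (rule level_sum_add)

lemma upper_sum_add: "upper_sum i (m + m') k = upper_sum i m k + upper_sum i m' k"
  unfolding upper_sum_def by (rule level_sum_add)

lemma finite_range_level_sum:
  "finite (range (\<lambda>k. \<Sum>t | P k t \<and> (i, t) \<in> Poly_Mapping.keys (m :: monomial). Poly_Mapping.lookup m (i, t)))"
  by (rule finite_subset[of _ "sum (\<lambda>t. Poly_Mapping.lookup m (i, t)) ` Pow {t. (i, t) \<in> Poly_Mapping.keys m}"])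
    (auto simp: finite_levels)

lemma finite_range_lower_sum: "finite (range (lower_sum i m))"
  unfolding lower_sum_def[abs_def] by (rule finite_range_level_sum)

lemma finite_range_upper_sum: "finite (range (upper_sum i m))"
  unfolding upper_sum_def[abs_def] by (rule finite_range_level_sum)

lemma lower_sum_zero:
  assumes "\<And>t. t \<le> k \<Longrightarrow> Poly_Mapping.lookup m (i, t) = 0"
  shows "lower_sum i m k = 0"
  unfolding lower_sum_def using assms by (intro sum.neutral) auto

lemma upper_sum_zero:
  assumes "\<And>t. k \<le> t \<Longrightarrow> Poly_Mapping.lookup m (i, t) = 0"
  shows "upper_sum i m k = 0"
  unfolding upper_sum_def using assms by (intro sum.neutral) auto

lemma bounded_levels:
  obtains K where "\<And>t. \<bar>t\<bar> \<ge> K \<Longrightarrow> Poly_Mapping.lookup (m :: monomial) (i, t) = 0"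
proof
  let ?T = "{t. (i, t) \<in> Poly_Mapping.keys m}"
  have T: "finite (insert 0 (abs ` ?T))" by (simp add: finite_levels)
  fix t assume t: "\<bar>t\<bar> \<ge> Max (insert 0 (abs ` ?T)) + 1"
  show "Poly_Mapping.lookup m (i, t) = 0"
  proof (rule ccontr)
    assume "Poly_Mapping.lookup m (i, t) \<noteq> 0"
    then have "\<bar>t\<bar> \<le> Max (insert 0 (abs ` ?T))"
      by (intro Max_ge[OF T]) (simp add: in_keys_iff)
    then show False using t by simp
  qed
qed

lemma lower_sum_le_mon_phi: "lower_sum i m k \<le> mon_phi i m"
  unfolding mon_phi_def by (rule Max_ge) (auto simp: finite_range_lower_sum)

lemma mon_phi_attained: "\<exists>k. mon_phi i m = lower_sum i m k"
  unfolding mon_phi_def using Max_in[OF finite_range_lower_sum, of i m] by auto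

lemma mon_phi_eqI:
  assumes "\<And>k. lower_sum i m k \<le> v" "lower_sum i m k = v"
  shows "mon_phi i m = v"
  using assms mon_phi_attained[of i m] lower_sum_le_mon_phi[of i m] by (metis antisym)

lemma upper_sum_ge_mon_eps: "- upper_sum i m k \<le> mon_eps i m"
  unfolding mon_eps_def by (simp add: finite_range_upper_sum)

lemma mon_eps_attained: "\<exists>k. mon_eps i m = - upper_sum i m k"
  unfolding mon_eps_def using Min_in[OF finite_range_upper_sum, of i m] by auto

lemma mon_eps_eqI:
  assumes "\<And>k. - upper_sum i m k \<le> v" "- upper_sum i m k = v"
  shows "mon_eps i m = v"
  using assms mon_eps_attained[of i m] upper_sum_ge_mon_eps[of i m] by (metis antisym)

lemma mon_phi_nonneg: "mon_phi i m \<ge> 0"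
proof -
  obtain K where "\<And>t. \<bar>t\<bar> \<ge> K \<Longrightarrow> Poly_Mapping.lookup m (i, t) = 0"
    using bounded_levels[of m i] by blast
  then have "lower_sum i m (- \<bar>K\<bar>) = 0" by (intro lower_sum_zero) auto
  then show ?thesis using lower_sum_le_mon_phi[of i m "- \<bar>K\<bar>"] by simp
qed

lemma mon_eps_nonneg: "mon_eps i m \<ge> 0"
proof -
  obtain K where "\<And>t. \<bar>t\<bar> \<ge> K \<Longrightarrow> Poly_Mapping.lookup m (i, t) = 0"
    using bounded_levels[of m i] by blast
  then have "upper_sum i m \<bar>K\<bar> = 0" by (intro upper_sum_zero) auto
  then show ?thesis using upper_sum_ge_mon_eps[of i m "\<bar>K\<bar>"] by simp
qed

lemma k_e_eqI:
  assumes "mon_eps i m = - upper_sum i m k" "\<And>t. k < t \<Longrightarrow> mon_eps i m \<noteq> - upper_sum i m t"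
  shows "k_e i m = k"
  unfolding k_e_def using assms by (intro Greatest_equality) (blast intro: leI)+

text \<open>\<open>GREATEST\<close> is meaningful here because upper sums vanish far above, so a
  positive \<open>mon_eps\<close> is not attained there. The extremal levels may be unbounded below;
  hence the maximum is taken over a finite window that starts at one of them.\<close>

lemma k_e_greatest:
  assumes "mon_eps i m > 0"
  shows "mon_eps i m = - upper_sum i m (k_e i m)"
    and "k_e i m < t \<Longrightarrow> mon_eps i m \<noteq> - upper_sum i m t"
proof -
  obtain K where K: "\<And>t. \<bar>t\<bar> \<ge> K \<Longrightarrow> Poly_Mapping.lookup m (i, t) = 0"
    using bounded_levels[of m i] by blast
  have zero: "upper_sum i m t = 0" if "t \<ge> \<bar>K\<bar>" for t
    using K that by (intro upper_sum_zero) auto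
  obtain k0 where k0: "mon_eps i m = - upper_sum i m k0" using mon_eps_attained by blast
  define S where "S = {k0..\<bar>K\<bar>} \<inter> {k. mon_eps i m = - upper_sum i m k}"
  have "k0 < \<bar>K\<bar>" using zero[of k0] k0 assms by (cases "k0 < \<bar>K\<bar>") auto
  then have S: "finite S" "k0 \<in> S" using k0 by (auto simp: S_def)
  then have Max: "Max S \<in> S" "k0 \<le> Max S" using Max_in Max_ge by blast+
  have attained: "mon_eps i m = - upper_sum i m k" if "k \<in> S" for k
    using that by (simp add: S_def)
  have above: "mon_eps i m \<noteq> - upper_sum i m t" if "Max S < t" for t
  proof
    assume t: "mon_eps i m = - upper_sum i m t"
    then have "t < \<bar>K\<bar>" using zero[of t] assms by (cases "t < \<bar>K\<bar>") auto
    then have "t \<in> S" unfolding S_def using t that Max(2) by simp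
    then show False using Max_ge[OF S(1)] that by fastforce
  qed
  have "k_e i m = Max S" using attained[OF Max(1)] above by (rule k_e_eqI)
  then show "mon_eps i m = - upper_sum i m (k_e i m)"
    "k_e i m < t \<Longrightarrow> mon_eps i m \<noteq> - upper_sum i m t"
    using attained[OF Max(1)] above by simp_all
qed

lemma lookup_mon_wt:
  assumes "finite T" "\<And>t. t \<notin> T \<Longrightarrow> Poly_Mapping.lookup m (i, t) = 0"
  shows "Poly_Mapping.lookup (wt (monomial_crystal n S) m) i = (\<Sum>t\<in>T. Poly_Mapping.lookup m (i, t))"
proof -
  have "Poly_Mapping.lookup (wt (monomial_crystal n S) m) i =
      (\<Sum>p\<in>Poly_Mapping.keys m. if fst p = i then Poly_Mapping.lookup m p else 0)"
    by (auto simp: monomial_crystal_def lookup_sum lookup_single when_def intro!: sum.cong)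
  also have "\<dots> = (\<Sum>p\<in>Pair i ` T. Poly_Mapping.lookup m p)"
    using assms
    by (intro sum.mono_neutral_cong) (auto simp: in_keys_iff image_iff)
  also have "\<dots> = (\<Sum>t\<in>T. Poly_Mapping.lookup m (i, t))"
    by (subst sum.reindex) (auto simp: inj_on_def)
  finally show ?thesis .
qed

text \<open>An upper sum that starts no higher than the lowest occupied level is the total exponent.
  This is how the weight term of the tensor rule for \<open>eps\<close> arises.\<close>

lemma upper_sum_eq_pairing:
  assumes "\<And>t. t < k \<Longrightarrow> Poly_Mapping.lookup m (i, t) = 0"
  shows "upper_sum i m k = pairing i (wt (monomial_crystal n S) m)"
proof -
  have "pairing i (wt (monomial_crystal n S) m) =
      (\<Sum>t | (i, t) \<in> Poly_Mapping.keys m. Poly_Mapping.lookup m (i, t))"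
    unfolding pairing_def by (rule lookup_mon_wt[OF finite_levels]) (simp add: in_keys_iff)
  also have "\<dots> = upper_sum i m k"
    unfolding upper_sum_def using assms by (intro sum.cong) (auto simp: in_keys_iff not_less[symmetric])
  finally show ?thesis by simp
qed

lemma mon_wt_add:
  "wt (monomial_crystal n S) (m + m') = wt (monomial_crystal n S) m + wt (monomial_crystal n S) m'"
proof (rule poly_mapping_eqI)
  fix i
  let ?T = "{t. (i, t) \<in> Poly_Mapping.keys m} \<union> {t. (i, t) \<in> Poly_Mapping.keys m'}"
  have T: "finite ?T" by (simp add: finite_levels)
  show "Poly_Mapping.lookup (wt (monomial_crystal n S) (m + m')) i =
      Poly_Mapping.lookup (wt (monomial_crystal n S) m + wt (monomial_crystal n S) m') i"
    by (subst lookup_add, subst (1 2 3) lookup_mon_wt[OF T])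
      (auto simp: in_keys_iff lookup_add sum.distrib)
qed

section \<open>The monomials of vectors\<close>

definition KR_mon :: "nat \<Rightarrow> int \<Rightarrow> (nat \<Rightarrow> nat) \<Rightarrow> monomial" where
  "KR_mon n j x = (\<Sum>i<n. Ypow (prv n i) (j + 1) (- int (x i)) + Ypow i j (int (x i)))"

text \<open>Collecting the factors by the first index shows both structure functions: for fixed
  \<open>i\<close> the exponent is phi_i = \<open>x i\<close> at level \<open>j\<close> and minus
  eps_i = \<open>x (nxt n i)\<close> at level \<open>j + 1\<close>.\<close>

lemma lookup_KR_mon:
  "Poly_Mapping.lookup (KR_mon n j x) (i, k) =
     (if i < n then of_bool (k = j) * int (x i) - of_bool (k = j + 1) * int (x (nxt n i)) else 0)"
proof -
  have "Poly_Mapping.lookup (KR_mon n j x) (i, k) =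
      (\<Sum>l<n. if prv n l = i \<and> k = j + 1 then - int (x l) else 0) +
      (\<Sum>l<n. if l = i \<and> k = j then int (x l) else 0)"
    by (auto simp: KR_mon_def Ypow_def lookup_sum lookup_add lookup_single when_def sum.distrib
        intro!: arg_cong2[where f = "(+)"] sum.cong)
  also have "(\<Sum>l<n. if prv n l = i \<and> k = j + 1 then - int (x l) else 0) =
      (\<Sum>l<n. if l = i \<and> k = j + 1 then - int (x (nxt n l)) else 0)"
    by (subst sum_nxt[symmetric]) (auto simp: prv_nxt intro!: sum.cong)
  finally show ?thesis by (simp add: sum.If_cases)
qed

lemma tau_M1: "tau j ` M1 n s = KR_mon n j ` elts (KR_crystal n s)"
proof -
  have tau: "tau j (KR_mon n 0 x) = KR_mon n j x" for x
    by (rule poly_mapping_eqI) (auto simp: lookup_tau lookup_KR_mon split: prod.splits)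
  have M1: "M1 n s = {KR_mon n 0 x | x. (\<Sum>i<n. x i) = s}"
    by (simp add: M1_def KR_mon_def)
  \<comment> \<open>\<open>M1\<close> allows arbitrary values of \<open>x\<close> outside the
    residues, the crystal of vectors only 0; truncating \<open>x\<close> does not change its
    monomial.\<close>
  have "KR_mon n 0 x \<in> KR_mon n 0 ` elts (KR_crystal n s)" if "(\<Sum>i<n. x i) = s" for x
    by (rule image_eqI[of _ _ "\<lambda>i. if i < n then x i else 0"])
      (use that in \<open>simp_all add: KR_mon_def KR_simps\<close>)
  then have "M1 n s = KR_mon n 0 ` elts (KR_crystal n s)"
    unfolding M1 by (auto simp: KR_simps)
  then show ?thesis by (simp add: image_image tau)
qed

lemma lower_sum_KR_mon:
  assumes "i < n"
  shows "lower_sum i (KR_mon n j x) k =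
    (if k < j then 0 else if k = j then int (x i) else int (x i) - int (x (nxt n i)))"
  by (subst lower_sum_superset[of "{j, j + 1}"]) (use assms in \<open>auto simp: lookup_KR_mon\<close>)

lemma upper_sum_KR_mon:
  assumes "i < n"
  shows "upper_sum i (KR_mon n j x) k =
    (if k \<le> j then int (x i) - int (x (nxt n i)) else if k = j + 1 then - int (x (nxt n i)) else 0)"
  by (subst upper_sum_superset[of "{j, j + 1}"]) (use assms in \<open>auto simp: lookup_KR_mon\<close>)

text \<open>The entry \<open>x i\<close> appears in Y_{i,j} and Y_{i-1,j+1}^{-1}, the entry
  \<open>x (nxt n i)\<close> in Y_{i+1,j} and Y_{i,j+1}^{-1}. These are the four factors of
  A_{i,j}.\<close>

lemma KR_mon_move:
  assumes "i < n" "n \<ge> 2" "x i \<noteq> 0"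
  shows "KR_mon n j (move n i x) = KR_mon n j x - A_mon n i j"
proof (rule poly_mapping_eqI)
  fix p :: "nat \<times> int"
  obtain l k where p: "p = (l, k)" by (cases p)
  have "nxt n l = i \<longleftrightarrow> l = prv n i" "nxt n l = nxt n i \<longleftrightarrow> l = i" if "l < n"
    using nxt_eq_iff nxt_inj assms that by auto
  moreover have "nxt n i \<noteq> i" "prv n i \<noteq> i" "nxt n i < n" "prv n i < n"
    using assms nxt_neq prv_neq nxt_less prv_less by auto
  ultimately show "Poly_Mapping.lookup (KR_mon n j (move n i x)) p =
      Poly_Mapping.lookup (KR_mon n j x - A_mon n i j) p"
    using assms
    by (auto simp: p lookup_minus lookup_add lookup_KR_mon A_mon_def Ypow_def lookup_single when_def move_def)
qed

section \<open>Multiplication by the lowest factor\<close>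

lemma monomial_crystal_simps:
  "elts (monomial_crystal n S) = S"
  "e_op (monomial_crystal n S) i m = (if mon_eps i m = 0 then None else Some (m + A_mon n i (k_e i m - 1)))"
  "f_op (monomial_crystal n S) i m = (if mon_phi i m = 0 then None else Some (m - A_mon n i (k_f i m)))"
  "eps (monomial_crystal n S) = mon_eps"
  "phi (monomial_crystal n S) = mon_phi"
  by (simp_all add: monomial_crystal_def)

text \<open>The lower sums of the product are 0 below \<open>j\<close>, then \<open>x i\<close> at
  \<open>j\<close>, and above \<open>j\<close> those of \<open>m\<close> shifted by the weight of
  \<open>x\<close>. Their maximum is phi of the tensor product.\<close>

lemma mon_phi_KR_mon_add:
  assumes i: "i < n" and low: "\<And>t. t \<le> j \<Longrightarrow> Poly_Mapping.lookup m (i, t) = 0"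
  shows "mon_phi i (KR_mon n j x + m) = max (int (x i)) (mon_phi i m + (int (x i) - int (x (nxt n i))))"
proof -
  have lower: "lower_sum i m t = 0" if "t \<le> j" for t
    using low that by (intro lower_sum_zero) auto
  have "lower_sum i (KR_mon n j x + m) t \<le> max (int (x i)) (mon_phi i m + (int (x i) - int (x (nxt n i))))" for t
    using lower_sum_le_mon_phi[of i m t] i lower[of t]
    by (auto simp: lower_sum_add lower_sum_KR_mon)
  moreover have "\<exists>t. lower_sum i (KR_mon n j x + m) t = max (int (x i)) (mon_phi i m + (int (x i) - int (x (nxt n i))))"
  proof (cases "mon_phi i m \<le> int (x (nxt n i))")
    case True
    then show ?thesis
      using i lower[of j] by (intro exI[of _ j]) (auto simp: lower_sum_add lower_sum_KR_mon)
  next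
    case False
    obtain t where t: "mon_phi i m = lower_sum i m t" using mon_phi_attained by blast
    \<comment> \<open>Here \<open>mon_phi i m\<close> is positive, so it is not attained among the
      vanishing sums up to level \<open>j\<close>.\<close>
    then have "j < t" using lower[of t] False by (cases "j < t") auto
    then show ?thesis
      using i t False by (intro exI[of _ t]) (auto simp: lower_sum_add lower_sum_KR_mon)
  qed
  ultimately show ?thesis using mon_phi_eqI by metis
qed

text \<open>In case of equality several levels are extremal and the minimum selects
  \<open>j\<close>, as f_i selects the left factor. In the strict case the extremal levels of the
  product are exactly those of \<open>m\<close>.\<close>

lemma k_f_KR_mon_add:
  assumes i: "i < n" and low: "\<And>t. t \<le> j \<Longrightarrow> Poly_Mapping.lookup m (i, t) = 0"
  shows "\<lbrakk>mon_phi i m \<le> int (x (nxt n i)); x i \<noteq> 0\<rbrakk> \<Longrightarrow> k_f i (KR_mon n j x + m) = j"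
    and "int (x (nxt n i)) < mon_phi i m \<Longrightarrow> k_f i (KR_mon n j x + m) = k_f i m"
proof -
  have lower: "lower_sum i m t = 0" if "t \<le> j" for t
    using low that by (intro lower_sum_zero) auto
  note phi = mon_phi_KR_mon_add[OF i low, where x = x]
  show "k_f i (KR_mon n j x + m) = j" if "mon_phi i m \<le> int (x (nxt n i))" "x i \<noteq> 0"
    unfolding k_f_def
  proof (rule Least_equality)
    show "mon_phi i (KR_mon n j x + m) = lower_sum i (KR_mon n j x + m) j"
      using phi that i lower[of j] by (simp add: lower_sum_add lower_sum_KR_mon)
    fix t assume t: "mon_phi i (KR_mon n j x + m) = lower_sum i (KR_mon n j x + m) t"
    show "j \<le> t"
      using phi that i lower[of t] t
      by (cases "j \<le> t") (auto simp: lower_sum_add lower_sum_KR_mon)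
  qed
  show "k_f i (KR_mon n j x + m) = k_f i m" if "int (x (nxt n i)) < mon_phi i m"
  proof -
    have "mon_phi i (KR_mon n j x + m) = lower_sum i (KR_mon n j x + m) t \<longleftrightarrow>
        mon_phi i m = lower_sum i m t" for t
      using phi that i lower[of t] by (auto simp: lower_sum_add lower_sum_KR_mon)
    then show ?thesis by (simp add: k_f_def)
  qed
qed

lemma mon_eps_KR_mon_add:
  fixes m :: monomial and S :: "monomial set"
  assumes i: "i < n" and low: "\<And>t. t \<le> j \<Longrightarrow> Poly_Mapping.lookup m (i, t) = 0"
  defines "w \<equiv> pairing i (wt (monomial_crystal n S) m)"
  shows "mon_eps i (KR_mon n j x + m) = max (mon_eps i m) (int (x (nxt n i)) - w)"
proof -
  have upper: "upper_sum i m t = w" if "t \<le> j + 1" for t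
    unfolding w_def using low that by (intro upper_sum_eq_pairing) auto
  have "- upper_sum i (KR_mon n j x + m) t \<le> max (mon_eps i m) (int (x (nxt n i)) - w)" for t
    using upper_sum_ge_mon_eps[of i m t] i upper[of t]
    by (auto simp: upper_sum_add upper_sum_KR_mon)
  moreover have "\<exists>t. - upper_sum i (KR_mon n j x + m) t = max (mon_eps i m) (int (x (nxt n i)) - w)"
  proof (cases "mon_eps i m \<le> int (x (nxt n i)) - w")
    case True
    then show ?thesis
      using i upper[of "j + 1"] by (intro exI[of _ "j + 1"]) (auto simp: upper_sum_add upper_sum_KR_mon)
  next
    case False
    obtain t where t: "mon_eps i m = - upper_sum i m t" using mon_eps_attained by blast
    then have "j + 1 < t" using upper[of t] False by (cases "j + 1 < t") auto
    then show ?thesis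
      using i t False by (intro exI[of _ t]) (auto simp: upper_sum_add upper_sum_KR_mon)
  qed
  ultimately show ?thesis using mon_eps_eqI by metis
qed

text \<open>With \<open>mon_phi i m = mon_eps i m + w\<close>, the two cases are those of the tensor
  rule for e_i. Unlike for \<open>k_f\<close>, the sets of extremal levels can differ below the
  overlap, so only their greatest elements are compared.\<close>

lemma k_e_KR_mon_add:
  fixes m :: monomial and S :: "monomial set"
  assumes i: "i < n" and low: "\<And>t. t \<le> j \<Longrightarrow> Poly_Mapping.lookup m (i, t) = 0"
  defines "w \<equiv> pairing i (wt (monomial_crystal n S) m)"
  shows "mon_eps i m < int (x (nxt n i)) - w \<Longrightarrow> k_e i (KR_mon n j x + m) = j + 1"
    and "\<lbrakk>int (x (nxt n i)) - w \<le> mon_eps i m; mon_eps i m \<noteq> 0\<rbrakk> \<Longrightarrow>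
      k_e i (KR_mon n j x + m) = k_e i m"
proof -
  have upper: "upper_sum i m t = w" if "t \<le> j + 1" for t
    unfolding w_def using low that by (intro upper_sum_eq_pairing) auto
  note eps = mon_eps_KR_mon_add[OF i low, where x = x and S = S, folded w_def]
  show "k_e i (KR_mon n j x + m) = j + 1" if "mon_eps i m < int (x (nxt n i)) - w"
  proof (rule k_e_eqI)
    show "mon_eps i (KR_mon n j x + m) = - upper_sum i (KR_mon n j x + m) (j + 1)"
      using eps that i upper[of "j + 1"] by (simp add: upper_sum_add upper_sum_KR_mon)
    fix t assume "j + 1 < t"
    then show "mon_eps i (KR_mon n j x + m) \<noteq> - upper_sum i (KR_mon n j x + m) t"
      using eps that i upper_sum_ge_mon_eps[of i m t] by (simp add: upper_sum_add upper_sum_KR_mon)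
  qed
  show "k_e i (KR_mon n j x + m) = k_e i m"
    if le: "int (x (nxt n i)) - w \<le> mon_eps i m" and "mon_eps i m \<noteq> 0"
  proof -
    have "mon_eps i m > 0" using mon_eps_nonneg[of i m] that by simp
    note K = k_e_greatest[OF this]
    \<comment> \<open>All upper sums of \<open>m\<close> up to level \<open>j + 1\<close> equal
      \<open>w\<close>, so the greatest extremal level is at least \<open>j + 1\<close>. If it is
      \<open>j + 1\<close> itself, then \<open>mon_eps i m = - w\<close>, and \<open>le\<close>
      forces \<open>x (nxt n i) = 0\<close>, so the sum there is unchanged.\<close>
    have K_ge: "j + 1 \<le> k_e i m"
      using K(1) K(2)[of "j + 1"] upper[of "j + 1"] upper[of "k_e i m"] by fastforce
    show ?thesis
    proof (rule k_e_eqI)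
      show "mon_eps i (KR_mon n j x + m) = - upper_sum i (KR_mon n j x + m) (k_e i m)"
        using eps le i K(1) K_ge upper[of "k_e i m"]
        by (auto simp: upper_sum_add upper_sum_KR_mon)
      fix t assume "k_e i m < t"
      then show "mon_eps i (KR_mon n j x + m) \<noteq> - upper_sum i (KR_mon n j x + m) t"
        using eps le i K(2)[of t] K_ge by (simp add: upper_sum_add upper_sum_KR_mon)
    qed
  qed
qed

lemma mon_wt_KR_mon: "wt (monomial_crystal n S) (KR_mon n j x) = wt (KR_crystal n s) x"
proof (rule poly_mapping_eqI)
  fix i
  show "Poly_Mapping.lookup (wt (monomial_crystal n S) (KR_mon n j x)) i =
      Poly_Mapping.lookup (wt (KR_crystal n s) x) i"
    by (subst lookup_mon_wt[of "{j, j + 1}"]) (auto simp: lookup_KR_mon lookup_KR_wt)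
qed

lemma mon_wt_indep: "wt (monomial_crystal n S) = wt (monomial_crystal n S')"
  by (simp add: monomial_crystal_def)

text \<open>One peeling step. Its conclusion includes that the enlarged set of monomials is a
  crystal, so the step can be iterated.\<close>

lemma tensor_KR_monomial_crystal:
  assumes n: "n \<ge> 3" and S: "crystal n (monomial_crystal n S)"
    and low: "\<And>m i t. \<lbrakk>m \<in> S; t \<le> j\<rbrakk> \<Longrightarrow> Poly_Mapping.lookup m (i, t) = 0"
  shows "crystal_isomorphic n (tensor (KR_crystal n s) (monomial_crystal n S))
    (monomial_crystal n ((\<lambda>(x, m). KR_mon n j x + m) ` (elts (KR_crystal n s) \<times> S)))"
    (is "crystal_isomorphic n ?T (monomial_crystal n (?\<psi> ` _))")
proof (rule crystal_isomorphicI[where \<psi> = ?\<psi>])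
  show "crystal n ?T" using n S by (intro crystal_tensor crystal_KR)
  have "inj_on ?\<psi> (elts (KR_crystal n s) \<times> S)"
  proof (rule inj_onI, clarify)
    fix x m x' m'
    assume x: "x \<in> elts (KR_crystal n s)" "x' \<in> elts (KR_crystal n s)" and m: "m \<in> S" "m' \<in> S"
      and eq: "KR_mon n j x + m = KR_mon n j x' + m'"
    have "x i = x' i" for i
    proof (cases "i < n")
      case True
      have "Poly_Mapping.lookup (KR_mon n j x + m) (i, j) = Poly_Mapping.lookup (KR_mon n j x' + m') (i, j)"
        using eq by simp
      then show ?thesis using True low m by (simp add: lookup_add lookup_KR_mon)
    next
      case False
      then show ?thesis using x by (simp add: KR_simps)
    qed
    then have "x = x'" by blast
    then show "x = x' \<and> m = m'" using eq by simp
  qed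
  then have bij: "bij_betw ?\<psi> (elts ?T) (?\<psi> ` (elts (KR_crystal n s) \<times> S))"
    by (simp add: tensor_simps monomial_crystal_simps bij_betw_def)
  let ?M = "monomial_crystal n (?\<psi> ` (elts (KR_crystal n s) \<times> S))"
  have ops: "eps ?M i (?\<psi> p) = eps ?T i p \<and> phi ?M i (?\<psi> p) = phi ?T i p \<and>
      e_op ?M i (?\<psi> p) = map_option ?\<psi> (e_op ?T i p) \<and>
      f_op ?M i (?\<psi> p) = map_option ?\<psi> (f_op ?T i p)"
    if i: "i < n" and p: "p \<in> elts ?T" for i p
  proof -
    obtain x m where p_eq: "p = (x, m)" and m: "m \<in> S"
      using p by (auto simp: tensor_simps monomial_crystal_simps)
    have lowm: "Poly_Mapping.lookup m (i, t) = 0" if "t \<le> j" for t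
      using low m that by blast
    define w where "w = pairing i (wt (monomial_crystal n S) m)"
    have phi_m: "mon_phi i m = mon_eps i m + w"
      using crystal.phi_eps[OF S, of i m] i m by (simp add: monomial_crystal_simps w_def)
    note phi = mon_phi_KR_mon_add[OF i lowm, where x = x]
    note eps = mon_eps_KR_mon_add[OF i lowm, where x = x and S = S, folded w_def]
    note k_f = k_f_KR_mon_add[OF i lowm, where x = x]
    note k_e = k_e_KR_mon_add[OF i lowm, where x = x and S = S, folded w_def]
    have f: "f_op ?M i (KR_mon n j x + m) = map_option ?\<psi> (f_op ?T i (x, m))"
    proof (cases "mon_phi i m \<le> int (x (nxt n i))")
      case True
      then show ?thesis
        using phi k_f(1) KR_mon_move[of i n x j] i n
        by (auto simp: tensor_simps monomial_crystal_simps KR_simps max_def)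
    next
      case False
      then show ?thesis
        using phi k_f(2) by (auto simp: tensor_simps monomial_crystal_simps KR_simps)
    qed
    have e: "e_op ?M i (KR_mon n j x + m) = map_option ?\<psi> (e_op ?T i (x, m))"
    proof (cases "mon_phi i m < int (x (nxt n i))")
      case True
      let ?x = "x(i := x i + 1, nxt n i := x (nxt n i) - 1)"
      have ne: "x (nxt n i) \<noteq> 0" "nxt n i \<noteq> i"
        using True mon_phi_nonneg[of i m] nxt_neq[OF i] n by auto
      then have "move n i ?x = x" by (auto simp: move_def fun_eq_iff)
      \<comment> \<open>In this case \<open>k_e\<close> is \<open>j + 1\<close>, and the shift by 1
        in the definition of e_i on monomials gives exactly A_{i,j}.\<close>
      then have "KR_mon n j ?x = KR_mon n j x + A_mon n i j"
        using KR_mon_move[of i n ?x j] i n ne by (auto simp: algebra_simps)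
      moreover have "e_op (KR_crystal n s) i x = Some ?x" using ne by (simp add: KR_crystal_def)
      ultimately show ?thesis
        using eps k_e(1) True phi_m mon_eps_nonneg[of i m]
        by (auto simp: tensor_simps monomial_crystal_simps KR_simps)
    next
      case False
      then show ?thesis
        using eps k_e(2) phi_m mon_eps_nonneg[of i m]
        by (auto simp: tensor_simps monomial_crystal_simps KR_simps max_def)
    qed
    have "mon_eps i (KR_mon n j x + m) = eps ?T i (x, m)"
      using eps by (simp add: tensor_simps monomial_crystal_simps KR_simps w_def)
    moreover have "mon_phi i (KR_mon n j x + m) = phi ?T i (x, m)"
      using phi i by (simp add: tensor_simps monomial_crystal_simps KR_simps pairing_KR_wt)
    ultimately show ?thesis
      unfolding p_eq prod.case monomial_crystal_simps(4,5) using e f by blast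
  qed
  have "wt ?M = wt (monomial_crystal n S)" by (rule mon_wt_indep)
  then have "wt ?M (?\<psi> p) = wt ?T p" for p
    using mon_wt_KR_mon[of n S j _ s] by (cases p) (simp add: tensor_simps(6) mon_wt_add)
  with ops bij show "crystal_isomorphism n ?\<psi> ?T ?M"
    unfolding crystal_isomorphism_def monomial_crystal_simps(1) by blast
qed

text \<open>The monomial 1, written additively as 0, spans a right unit for the tensor product. It
  stands in for the missing empty product, so that the last factor can be peeled off like the
  others.\<close>

lemma crystal_monomial_one: "crystal n (monomial_crystal n {0})"
  and tensor_KR_monomial_one: "n \<ge> 3 \<Longrightarrow>
    crystal_isomorphic n (KR_crystal n s) (tensor (KR_crystal n s) (monomial_crystal n {0}))"
proof -
  have zero: "mon_phi i 0 = 0" "mon_eps i 0 = 0" for i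
    by (auto intro!: mon_phi_eqI mon_eps_eqI simp: lower_sum_def upper_sum_def)
  have wt: "wt (monomial_crystal n {0}) 0 = 0"
    by (simp add: monomial_crystal_def)
  show "crystal n (monomial_crystal n {0})"
    by (rule crystalI) (auto simp: monomial_crystal_simps zero wt pairing_def)
  show "crystal_isomorphic n (KR_crystal n s) (tensor (KR_crystal n s) (monomial_crystal n {0}))"
    if n: "n \<ge> 3"
  proof (rule crystal_isomorphicI[OF crystal_KR[OF n], where \<psi> = "\<lambda>x. (x, 0)"])
    have "bij_betw (\<lambda>x. (x, 0)) (elts (KR_crystal n s)) (elts (KR_crystal n s) \<times> {0})"
      by (auto simp: bij_betw_def inj_on_def)
    \<comment> \<open>If eps_i of \<open>x\<close> is 0, the tensor rule passes e_i to the trivial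
      factor, where it is undefined; so it must be undefined on \<open>x\<close> as well.\<close>
    moreover have "e_op (KR_crystal n s) i x = None" if "x (nxt n i) = 0" for i x
      using that by (simp add: KR_crystal_def)
    ultimately show "crystal_isomorphism n (\<lambda>x. (x, 0)) (KR_crystal n s)
        (tensor (KR_crystal n s) (monomial_crystal n {0}))"
      unfolding crystal_isomorphism_def
      by (auto simp: tensor_simps monomial_crystal_simps KR_simps zero wt pairing_KR_wt)
        (simp_all add: pairing_def)
  qed
qed

text \<open>\<open>M_prod\<close> for an arbitrary index set. Products of monomials do not depend on
  the order of the factors, so sorting the shifts affects only the tensor product.\<close>

definition mon_prod :: "nat \<Rightarrow> ('k \<Rightarrow> nat) \<Rightarrow> ('k \<Rightarrow> nat) \<Rightarrow> 'k set \<Rightarrow> monomial set" where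
  "mon_prod n s j K = {\<Sum>k\<in>K. tau (int (j k)) (m k) | m. \<forall>k\<in>K. m k \<in> M1 n (s k)}"

lemma mon_prod_insert:
  assumes "finite K" "k \<notin> K"
  shows "mon_prod n s j (insert k K) =
    (\<lambda>(x, m). KR_mon n (int (j k)) x + m) ` (elts (KR_crystal n (s k)) \<times> mon_prod n s j K)"
proof -
  have "mon_prod n s j (insert k K) = (\<lambda>(a, m). a + m) ` (tau (int (j k)) ` M1 n (s k) \<times> mon_prod n s j K)"
  proof (intro equalityI subsetI)
    fix p assume "p \<in> mon_prod n s j (insert k K)"
    then show "p \<in> (\<lambda>(a, m). a + m) ` (tau (int (j k)) ` M1 n (s k) \<times> mon_prod n s j K)"
      using assms by (fastforce simp: mon_prod_def)
  next
    fix p assume "p \<in> (\<lambda>(a, m). a + m) ` (tau (int (j k)) ` M1 n (s k) \<times> mon_prod n s j K)"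
    then obtain a m where a: "a \<in> M1 n (s k)" and m: "\<forall>k\<in>K. m k \<in> M1 n (s k)"
      and p: "p = tau (int (j k)) a + (\<Sum>k\<in>K. tau (int (j k)) (m k))"
      by (auto simp: mon_prod_def)
    have "(\<Sum>l\<in>K. tau (int (j l)) ((m(k := a)) l)) = (\<Sum>l\<in>K. tau (int (j l)) (m l))"
      using assms by (intro sum.cong) auto
    then show "p \<in> mon_prod n s j (insert k K)"
      unfolding mon_prod_def using assms a m p by (auto intro!: exI[of _ "m(k := a)"])
  qed
  then show ?thesis by (force simp: tau_M1)
qed

lemma mon_prod_low:
  assumes "finite K" "m \<in> mon_prod n s j K" "\<And>k. k \<in> K \<Longrightarrow> t < int (j k)"
  shows "Poly_Mapping.lookup m (i, t) = 0"
  using assms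
proof (induction K arbitrary: m)
  case (insert k K)
  obtain x m' where m: "m = KR_mon n (int (j k)) x + m'" "m' \<in> mon_prod n s j K"
    using insert.prems(1) insert.hyps by (auto simp: mon_prod_insert)
  have "Poly_Mapping.lookup m' (i, t) = 0" "t < int (j k)"
    using insert.IH[OF m(2)] insert.prems(2) by auto
  then show ?case by (simp add: m(1) lookup_add lookup_KR_mon)
qed (simp add: mon_prod_def)

text \<open>The head of the list has the smallest shift and is peeled off. Strict order is what
  makes the monomials of the tail vanish up to and including level \<open>j k\<close>.\<close>

lemma tensor_list_KR_monomial_crystal:
  assumes n: "n \<ge> 3" and "sorted_wrt (\<lambda>k l. j k < j l) ks" "ks \<noteq> []"
  shows "crystal_isomorphic n (tensor_list (map (\<lambda>k. KR_crystal n (s k)) ks))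
    (monomial_crystal n (mon_prod n s j (set ks)))"
  using assms(2,3)
proof (induction ks)
  case (Cons k ks)
  let ?B = "KR_crystal n (s k)" and ?Bs = "map (\<lambda>k. KR_crystal n (s k)) ks"
    and ?M = "monomial_crystal n (mon_prod n s j (set ks))"
  have B: "crystal n ?B" using n by (rule crystal_KR)
  have k: "k \<notin> set ks" "\<And>l. l \<in> set ks \<Longrightarrow> int (j k) < int (j l)" using Cons.prems by auto
  have "crystal_isomorphic n (tensor_list (?B # ?Bs)) (tensor ?B ?M) \<and> crystal n ?M"
  proof (cases "ks = []")
    case True
    then have M: "?M = monomial_crystal n {0}" by (simp add: mon_prod_def)
    have "crystal_isomorphic n (tensor_list [?B]) (tensor ?B ?M)"
      unfolding M using crystal_isomorphic_sym[OF tensor_list_single[OF B]] tensor_KR_monomial_one[OF n]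
      by (rule crystal_isomorphic_trans)
    then show ?thesis using True M crystal_monomial_one by simp
  next
    case False
    then have IH: "crystal_isomorphic n (tensor_list ?Bs) ?M" using Cons by simp
    then have "crystal_isomorphic n (tensor ?B (tensor_list ?Bs)) (tensor_list (?B # ?Bs))"
      using False B by (intro tensor_list_Cons) (auto simp: crystal_isomorphic_def)
    then have "crystal_isomorphic n (tensor_list (?B # ?Bs)) (tensor ?B ?M)"
      using crystal_isomorphic_sym crystal_isomorphic_trans
        tensor_cong[OF crystal_isomorphic_refl[OF B] IH] by blast
    then show ?thesis using IH by (simp add: crystal_isomorphic_def)
  qed
  moreover from this have "crystal_isomorphic n (tensor ?B ?M)
      (monomial_crystal n (mon_prod n s j (set (k # ks))))"
    using tensor_KR_monomial_crystal[OF n, of "mon_prod n s j (set ks)" "int (j k)" "s k"] k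
      mon_prod_low[of "set ks"]
    by (simp add: mon_prod_insert le_less_trans)
  ultimately show ?case using crystal_isomorphic_trans by auto
qed simp

text \<open>Each step of the insertion that moves \<open>k\<close> past a smaller key is one
  application of the R-matrix to the two leading factors.\<close>

lemma tensor_list_KR_insort:
  assumes n: "n \<ge> 3"
  shows "crystal_isomorphic n (tensor_list (map (\<lambda>k. KR_crystal n (s k)) (insort_key j k ks)))
    (tensor_list (map (\<lambda>k. KR_crystal n (s k)) (k # ks)))"
proof (induction ks)
  case Nil
  show ?case
    using crystal_KR[OF n] crystal_tensor_list[of "[KR_crystal n (s k)]" n]
    by (simp del: tensor_list.simps add: crystal_isomorphic_refl)
next
  case (Cons l ks)
  note cr = crystal_KR[OF n]
  show ?case
  proof (cases "j k \<le> j l")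
    case True
    then show ?thesis
      using cr by (auto simp del: tensor_list.simps intro!: crystal_isomorphic_refl crystal_tensor_list)
  next
    case False
    have "insort_key j k ks \<noteq> []" by (cases ks) auto
    then have "crystal_isomorphic n
        (tensor_list (map (\<lambda>k. KR_crystal n (s k)) (insort_key j k (l # ks))))
        (tensor_list (map (\<lambda>k. KR_crystal n (s k)) (l # k # ks)))"
      using tensor_list_Cons_cong[OF cr Cons.IH, of "s l"] False by (simp del: tensor_list.simps)
    also have "crystal_isomorphic n \<dots> (tensor_list (map (\<lambda>k. KR_crystal n (s k)) (k # l # ks)))"
      using tensor_list_swap[OF KR_tensor_commute[OF n] cr cr] cr by (simp del: tensor_list.simps)
    finally show ?thesis .
  qed
qed

lemma tensor_list_KR_sort:
  assumes n: "n \<ge> 3" and "ks \<noteq> []"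
  shows "crystal_isomorphic n (tensor_list (map (\<lambda>k. KR_crystal n (s k)) (sort_key j ks)))
    (tensor_list (map (\<lambda>k. KR_crystal n (s k)) ks))"
  using assms(2)
proof (induction ks)
  case (Cons k ks)
  note cr = crystal_KR[OF n]
  show ?case
  proof (cases "ks = []")
    case True
    then show ?thesis
      using cr by (auto simp del: tensor_list.simps intro!: crystal_isomorphic_refl crystal_tensor_list)
  next
    case False
    have "sort_key j ks \<noteq> []" using False by (metis length_0_conv length_sort)
    then have "crystal_isomorphic n
        (tensor_list (map (\<lambda>k. KR_crystal n (s k)) (k # sort_key j ks)))
        (tensor_list (map (\<lambda>k. KR_crystal n (s k)) (k # ks)))"
      using tensor_list_Cons_cong[OF cr Cons.IH[OF False]] False by (simp del: tensor_list.simps)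
    then show ?thesis
      using crystal_isomorphic_trans[OF tensor_list_KR_insort[OF n]] by (simp del: tensor_list.simps)
  qed
qed simp

theorem theorem4p3:
  fixes n N :: nat and s j :: "nat \<Rightarrow> nat"
  assumes "n \<ge> 3" and "N \<ge> 1"
    and "\<forall>k\<in>{1..N}. s k \<ge> 1"
    and "inj_on j {1..N}"
  shows "crystal_isomorphic n
           (monomial_crystal n (M_prod n N s j))
           (tensor_list (map (\<lambda>k. KR_crystal n (s k)) [1..<N + 1]))"
proof -
  let ?ks = "sort_key j [1..<N + 1]"
  have set: "set ?ks = {1..N}" by auto
  have nonempty: "[1..<N + 1] \<noteq> []" using \<open>N \<ge> 1\<close> by simp
  have ks: "?ks \<noteq> []" using set \<open>N \<ge> 1\<close> by fastforce
  \<comment> \<open>Sorting yields only a weakly increasing list of shifts; injectivity of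
    \<open>j\<close> makes it strict.\<close>
  have "distinct (map j ?ks)"
    using \<open>inj_on j {1..N}\<close> set by (simp add: distinct_map)
  then have sorted: "sorted_wrt (\<lambda>k l. j k < j l) ?ks"
    using sorted_sort_key[of j "[1..<N + 1]"] strict_sorted_iff[of "map j ?ks"]
    by (simp add: sorted_wrt_map)
  have M_prod: "M_prod n N s j = mon_prod n s j (set ?ks)"
    unfolding set mon_prod_def M_prod_def ..
  note tensor_list_KR_monomial_crystal[OF \<open>n \<ge> 3\<close> sorted ks, of s, folded M_prod]
  from crystal_isomorphic_sym[OF this] tensor_list_KR_sort[OF \<open>n \<ge> 3\<close> nonempty]
  show ?thesis by (rule crystal_isomorphic_trans)
qed

end
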